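(* Let $j\in\{0,\tfrac12,1,\tfrac32,\dots\}$ and $m\in\{-j,-j+1,\dots,j\}$. The $h$-symplecton is given explicitly by $$\tilde P_j^m(a,\bar a)=P_j^m(a,\bar a)\,e^{m\sigma},$$ where $P_j^m(a,\bar a)$ is the $sl(2)$ symplecton and $\sigma=-\ln(1-2hJ_+)=-\ln(1+ha^2)$. That is, the elements $\tilde P_j^m=P_j^m e^{m\sigma}$ ($-j\le m\le j$) satisfy $$\mathrm{ad}J_{\pm}(\tilde P_j^m)=\sqrt{(j\mp m)(j\pm m+1)}\;\tilde P_j^{m\pm1},\qquad \mathrm{ad}J_0(\tilde P_j^m)=2m\,\tilde P_j^m .$$
   Context: Let $a,\bar a$ be boson operators, i.e. generators of the Weyl algebra with $[\bar a,a]=1$; expressions involving $\sigma$ are understood as formal power series in the parameter $h$. Put $$J_+=-\tfrac12a^2,\qquad J_-=\tfrac12\bar a^2,\qquad J_0=\tfrac12(a\bar a+\bar a a),$$ which satisfy $[J_0,J_\pm]=\pm2J_\pm$, $[J_+,J_-]=J_0$. The $sl(2)$ symplecton is the family of polynomials $$P_j^m(a,\bar a)=\frac{1}{2^{j-m}}\left[\frac{(2j)!\,(j-m)!}{(j+m)!}\right]^{1/2}\sum_{s=0}^{j-m}\frac{\bar a^{\,j-m-s}a^{j+m}\bar a^{\,s}}{s!\,(j-m-s)!},$$ which satisfy $[J_\pm,P_j^m]=\sqrt{(j\mp m)(j\pm m+1)}\,P_j^{m\pm1}$ and $[J_0,P_j^m]=2mP_j^m$. The Jordanian quantum algebra $\mathcal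 U_h(sl(2))$ has the same commutation relations as $sl(2)$ (so the $J$'s above also realize it) and the Hopf algebra structure obtained from that of $\mathcal U(sl(2))$ by the Drinfeld twist $\mathcal F=\exp(-\tfrac12J_0\otimes\sigma)$, $\sigma=-\ln(1-2hJ_+)$: $\tilde\Delta=\mathcal F\Delta\mathcal F^{-1}$, $\tilde S=uSu^{-1}$, $u=m(\mathrm{id}\otimes S)(\mathcal F)$. The adjoint action of $X$ on an operator $t$ is $\mathrm{ad}X(t)=\sum X_{(1)}\,t\,\tilde S(X_{(2)})$ where $\tilde\Delta(X)=\sum X_{(1)}\otimes X_{(2)}$. Explicitly, $$\mathrm{ad}J_0(t)=[J_0,t]e^{-\sigma},\qquad \mathrm{ad}J_+(t)=e^{-\sigma}[J_+e^{\sigma},t],$$ $$\mathrm{ad}J_-(t)=[J_-+hJ_0+\tfrac h2J_0^2,\,t]e^{-\sigma}-h[J_0,t]e^{-2\sigma}-\tfrac h2[J_0,[J_0,t]]e^{-2\sigma}.$$ The $h$-symplecton $\tilde P_j^m(a,\bar a)$ is the family in $a,\bar a$ satisfying the displayed adjoint-action relations in the claim (these fix it only up to an overall normalization for each $j$, which is the one inherited from $P_j^m$). *)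

theory Defs
  imports Complex_Main "HOL-Computational_Algebra.Computational_Algebra"
begin

text \<open>
  The formal parameter \<open>h\<close> is \<^const>\<open>fps_X\<close>; it is central also when the coefficient algebra is
  noncommutative.  \<open>hsubst f x\<close> is the series \<open>\<Sum>i. f\<^sub>i x\<^sup>i\<close>; it is the \<open>h\<close>-adic sum when the constant
  term of \<open>x\<close> vanishes (then \<open>x\<^sup>i\<close> contributes nothing to the coefficient of \<open>h\<^sup>n\<close> for \<open>i > n\<close>).
\<close>

abbreviation hpar :: "'a::real_algebra_1 fps"
  where "hpar \<equiv> fps_X"

abbreviation hscale :: "real \<Rightarrow> 'a::real_algebra_1 fps \<Rightarrow> 'a fps"
  where "hscale c x \<equiv> fps_const (of_real c) * x"

definition hsubst :: "real fps \<Rightarrow> 'a::real_algebra_1 fps \<Rightarrow> 'a fps"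
  where "hsubst f x = Abs_fps (\<lambda>n. \<Sum>i\<le>n. (f $ i) *\<^sub>R ((x ^ i) $ n))"

definition hexp :: "'a::real_algebra_1 fps \<Rightarrow> 'a fps"
  where "hexp x = hsubst (fps_exp 1) x"

text \<open>For \<open>y\<close> with constant term \<open>1\<close>; \<^term>\<open>fps_ln 1\<close> is the series of \<open>ln (1 + X)\<close>.\<close>

definition hln :: "'a::real_algebra_1 fps \<Rightarrow> 'a fps"
  where "hln y = hsubst (fps_ln 1) (y - 1)"

text \<open>
  For a series with constant term \<open>1\<close>.  Over a ring \<^const>\<open>fps_left_inverse\<close> and
  \<^const>\<open>fps_right_inverse\<close> then agree and give the two-sided inverse.
\<close>

definition hinv :: "'a::real_algebra_1 fps \<Rightarrow> 'a fps"
  where "hinv y = fps_left_inverse y 1"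

text \<open>\<open>h\<close>-linear, \<open>h\<close>-adically continuous extension of a linear map.\<close>

definition hext :: "('u \<Rightarrow> 'b::comm_monoid_add fps) \<Rightarrow> 'u fps \<Rightarrow> 'b fps"
  where "hext \<phi> v = Abs_fps (\<lambda>n. \<Sum>i\<le>n. \<phi> (v $ i) $ (n - i))"

definition sigma :: "'a::real_algebra_1 \<Rightarrow> 'a fps"
  where "sigma jplus = - hln (1 - 2 * hpar * fps_const jplus)"

datatype 'g alg_term =
    Gen 'g
  | Scal real
  | Plus "'g alg_term" "'g alg_term"
  | Times "'g alg_term" "'g alg_term"

primrec term_eval :: "('g \<Rightarrow> 'a::real_algebra_1) \<Rightarrow> 'g alg_term \<Rightarrow> 'a" where
  "term_eval f (Gen g) = f g"
| "term_eval f (Scal c) = of_real c"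
| "term_eval f (Plus s t) = term_eval f s + term_eval f t"
| "term_eval f (Times s t) = term_eval f s * term_eval f t"

primrec term_anti_eval :: "('g \<Rightarrow> 'a::real_algebra_1) \<Rightarrow> 'g alg_term \<Rightarrow> 'a" where
  "term_anti_eval f (Gen g) = f g"
| "term_anti_eval f (Scal c) = of_real c"
| "term_anti_eval f (Plus s t) = term_anti_eval f s + term_anti_eval f t"
| "term_anti_eval f (Times s t) = term_anti_eval f t * term_anti_eval f s"

text \<open>
  The relations are required to hold when all generators are sent to \<open>0\<close> (as they do for enveloping
  algebras), which makes \<open>0 \<noteq> 1\<close> in the presented algebra.
\<close>

class presentation =
  fixes alg_rel :: "'a alg_term \<Rightarrow> 'a alg_term \<Rightarrow> bool"
  assumes alg_rel_augmented:
    "alg_rel s t \<Longrightarrow> term_eval (\<lambda>_. 0::real) s = term_eval (\<lambda>_. 0::real) t"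

inductive alg_eq :: "'g::presentation alg_term \<Rightarrow> 'g alg_term \<Rightarrow> bool" where
  rel: "alg_rel s t \<Longrightarrow> alg_eq s t"
| refl: "alg_eq s s"
| sym: "alg_eq s t \<Longrightarrow> alg_eq t s"
| trans: "alg_eq r s \<Longrightarrow> alg_eq s t \<Longrightarrow> alg_eq r t"
| cong_plus: "alg_eq s s' \<Longrightarrow> alg_eq t t' \<Longrightarrow> alg_eq (Plus s t) (Plus s' t')"
| cong_times: "alg_eq s s' \<Longrightarrow> alg_eq t t' \<Longrightarrow> alg_eq (Times s t) (Times s' t')"
| plus_assoc: "alg_eq (Plus (Plus r s) t) (Plus r (Plus s t))"
| plus_comm: "alg_eq (Plus s t) (Plus t s)"
| plus_zero: "alg_eq (Plus (Scal 0) t) t"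
| plus_minus: "alg_eq (Plus (Times (Scal (-1)) t) t) (Scal 0)"
| times_assoc: "alg_eq (Times (Times r s) t) (Times r (Times s t))"
| distrib_left: "alg_eq (Times r (Plus s t)) (Plus (Times r s) (Times r t))"
| distrib_right: "alg_eq (Times (Plus r s) t) (Plus (Times r t) (Times s t))"
| one_times: "alg_eq (Times (Scal 1) t) t"
| scal_central: "alg_eq (Times (Scal c) t) (Times t (Scal c))"
| scal_plus: "alg_eq (Scal (c + d)) (Plus (Scal c) (Scal d))"
| scal_times: "alg_eq (Scal (c * d)) (Times (Scal c) (Scal d))"

lemma alg_eq_augmented:
  "alg_eq s t \<Longrightarrow> term_eval (\<lambda>_. 0::real) s = term_eval (\<lambda>_. 0::real) t"
  by (induction rule: alg_eq.induct) (auto simp: alg_rel_augmented algebra_simps)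

quotient_type (overloaded) 'g presented = "'g::presentation alg_term" / alg_eq
  by (intro equivpI reflpI sympI transpI) (blast intro: alg_eq.intros)+

instantiation presented :: (presentation) real_algebra_1
begin

lift_definition zero_presented :: "'a presented" is "Scal 0" .
lift_definition one_presented :: "'a presented" is "Scal 1" .
lift_definition plus_presented :: "'a presented \<Rightarrow> 'a presented \<Rightarrow> 'a presented" is Plus
  by (rule alg_eq.cong_plus)
lift_definition times_presented :: "'a presented \<Rightarrow> 'a presented \<Rightarrow> 'a presented" is Times
  by (rule alg_eq.cong_times)
lift_definition scaleR_presented :: "real \<Rightarrow> 'a presented \<Rightarrow> 'a presented"
  is "\<lambda>c. Times (Scal c)"
  by (blast intro: alg_eq.cong_times alg_eq.refl)
lift_definition uminus_presented :: "'a presented \<Rightarrow> 'a presented" is "Times (Scal (-1))"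
  by (blast intro: alg_eq.cong_times alg_eq.refl)
definition minus_presented :: "'a presented \<Rightarrow> 'a presented \<Rightarrow> 'a presented"
  where "minus_presented x y = x + - y"

instance
proof
  fix x y z :: "'a presented" and c d :: real
  show "x + y + z = x + (y + z)" by transfer (rule alg_eq.plus_assoc)
  show "x + y = y + x" by transfer (rule alg_eq.plus_comm)
  show "0 + x = x" by transfer (rule alg_eq.plus_zero)
  show "- x + x = 0" by transfer (rule alg_eq.plus_minus)
  show "x - y = x + - y" by (rule minus_presented_def)
  show "x * y * z = x * (y * z)" by transfer (rule alg_eq.times_assoc)
  show "(x + y) * z = x * z + y * z" by transfer (rule alg_eq.distrib_right)
  show "x * (y + z) = x * y + x * z" by transfer (rule alg_eq.distrib_left)
  show "1 * x = x" by transfer (rule alg_eq.one_times)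
  show "x * 1 = x" by transfer (blast intro: alg_eq.one_times alg_eq.scal_central alg_eq.trans alg_eq.sym)
  show "(0::'a presented) \<noteq> 1"
    by transfer (auto dest: alg_eq_augmented)
  show "c *\<^sub>R (x + y) = c *\<^sub>R x + c *\<^sub>R y" by transfer (rule alg_eq.distrib_left)
  show "(c + d) *\<^sub>R x = c *\<^sub>R x + d *\<^sub>R x"
    by transfer (blast intro: alg_eq.distrib_right alg_eq.scal_plus alg_eq.cong_times alg_eq.refl alg_eq.trans)
  show "c *\<^sub>R d *\<^sub>R x = (c * d) *\<^sub>R x"
    by transfer (blast intro: alg_eq.times_assoc alg_eq.scal_times alg_eq.cong_times
        alg_eq.refl alg_eq.trans alg_eq.sym)
  show "1 *\<^sub>R x = x" by transfer (rule alg_eq.one_times)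
  show "c *\<^sub>R x * y = c *\<^sub>R (x * y)" by transfer (rule alg_eq.times_assoc)
  show "x * c *\<^sub>R y = c *\<^sub>R (x * y)"
    by transfer (blast intro: alg_eq.times_assoc alg_eq.scal_central alg_eq.cong_times
        alg_eq.refl alg_eq.trans alg_eq.sym)
qed

end

lift_definition gen :: "'g::presentation \<Rightarrow> 'g presented" is Gen .

text \<open>
  The algebra homomorphism (antihomomorphism) with prescribed values on the generators, evaluated on
  an arbitrary representative.  This is independent of the representative when the prescribed values
  satisfy the defining relations (in the opposite algebra, for the antihomomorphism).
\<close>

definition alg_hom :: "('g::presentation \<Rightarrow> 'a::real_algebra_1) \<Rightarrow> 'g presented \<Rightarrow> 'a"
  where "alg_hom f x = term_eval f (rep_presented x)"

definition alg_antihom :: "('g::presentation \<Rightarrow> 'a::real_algebra_1) \<Rightarrow> 'g presented \<Rightarrow> 'a"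
  where "alg_antihom f x = term_anti_eval f (rep_presented x)"

datatype sl2_gen = Plus_gen | Minus_gen | Zero_gen

abbreviation Comm :: "'g alg_term \<Rightarrow> 'g alg_term \<Rightarrow> 'g alg_term"
  where "Comm s t \<equiv> Plus (Times s t) (Times (Scal (-1)) (Times t s))"

instantiation sl2_gen :: presentation
begin

definition alg_rel_sl2_gen :: "sl2_gen alg_term \<Rightarrow> sl2_gen alg_term \<Rightarrow> bool" where
  "alg_rel_sl2_gen s t \<longleftrightarrow> (s, t) \<in>
    {(Comm (Gen Zero_gen) (Gen Plus_gen), Times (Scal 2) (Gen Plus_gen)),
     (Comm (Gen Zero_gen) (Gen Minus_gen), Times (Scal (-2)) (Gen Minus_gen)),
     (Comm (Gen Plus_gen) (Gen Minus_gen), Gen Zero_gen)}"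

instance by standard (auto simp: alg_rel_sl2_gen_def)

end

type_synonym usl2 = "sl2_gen presented"

abbreviation Jp :: usl2 where "Jp \<equiv> gen Plus_gen"
abbreviation Jm :: usl2 where "Jm \<equiv> gen Minus_gen"
abbreviation J0 :: usl2 where "J0 \<equiv> gen Zero_gen"

text \<open>
  The disjoint union of two sets of generators presents the tensor product of the two presented
  algebras: the relations of each factor hold and the two factors commute with each other.
\<close>

instantiation sum :: (presentation, presentation) presentation
begin

inductive alg_rel_sum :: "('a + 'b) alg_term \<Rightarrow> ('a + 'b) alg_term \<Rightarrow> bool" where
  left: "alg_rel s t \<Longrightarrow> alg_rel_sum (map_alg_term Inl s) (map_alg_term Inl t)"
| right: "alg_rel s t \<Longrightarrow> alg_rel_sum (map_alg_term Inr s) (map_alg_term Inr t)"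
| commute: "alg_rel_sum (Times (Gen (Inl x)) (Gen (Inr y))) (Times (Gen (Inr y)) (Gen (Inl x)))"

instance
proof
  have map_zero: "term_eval (\<lambda>_. 0::real) (map_alg_term f s) = term_eval (\<lambda>_. 0::real) s"
    for f :: "'x \<Rightarrow> 'a + 'b" and s
    by (induction s) auto
  show "term_eval (\<lambda>_. 0::real) s = term_eval (\<lambda>_. 0::real) t"
    if "alg_rel s t" for s t :: "('a + 'b) alg_term"
    using that by (induction rule: alg_rel_sum.induct) (auto simp: map_zero alg_rel_augmented)
qed

end

type_synonym usl2_tensor = "(sl2_gen + sl2_gen) presented"

definition tensor :: "usl2 \<Rightarrow> usl2 \<Rightarrow> usl2_tensor"  (infixl \<open>\<otimes>\<close> 75)
  where "x \<otimes> y = alg_hom (\<lambda>g. gen (Inl g)) x * alg_hom (\<lambda>g. gen (Inr g)) y"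

text \<open>
  Sweedler notation: for bilinear \<open>\<beta>\<close>, the value \<open>\<Sum> \<beta> X\<^sub>(\<^sub>1\<^sub>) X\<^sub>(\<^sub>2\<^sub>)\<close> at \<open>\<Sum> X\<^sub>(\<^sub>1\<^sub>) \<otimes> X\<^sub>(\<^sub>2\<^sub>)\<close>,
  which does not depend on the chosen finite sum.
\<close>

definition sweedler :: "(usl2 \<Rightarrow> usl2 \<Rightarrow> 'b::monoid_add) \<Rightarrow> usl2_tensor \<Rightarrow> 'b"
  where "sweedler \<beta> v =
    (THE w. \<exists>ps. v = (\<Sum>(x, y)\<leftarrow>ps. x \<otimes> y) \<and> w = (\<Sum>(x, y)\<leftarrow>ps. \<beta> x y))"

definition coproduct :: "usl2 \<Rightarrow> usl2_tensor"
  where "coproduct = alg_hom (\<lambda>g. gen g \<otimes> 1 + 1 \<otimes> gen g)"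

definition antipode :: "usl2 \<Rightarrow> usl2"
  where "antipode = alg_antihom (\<lambda>g. - gen g)"

definition twist :: "usl2_tensor fps"
  where "twist = hexp (hscale (-1/2) (hext (\<lambda>y. fps_const (J0 \<otimes> y)) (sigma Jp)))"

definition twisted_coproduct :: "usl2 \<Rightarrow> usl2_tensor fps"
  where "twisted_coproduct x = twist * fps_const (coproduct x) * hinv twist"

text \<open>\<open>u = m (id \<otimes> S) (F)\<close>\<close>

definition twist_u :: "usl2 fps"
  where "twist_u = hext (sweedler (\<lambda>x y. fps_const (x * antipode y))) twist"

definition twisted_antipode :: "usl2 \<Rightarrow> usl2 fps"
  where "twisted_antipode x = twist_u * fps_const (antipode x) * hinv twist_u"

definition boson_Jp :: "'a::real_algebra_1 \<Rightarrow> 'a"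
  where "boson_Jp a = - (1/2) *\<^sub>R a\<^sup>2"

definition boson_Jm :: "'a::real_algebra_1 \<Rightarrow> 'a"
  where "boson_Jm abar = (1/2) *\<^sub>R abar\<^sup>2"

definition boson_J0 :: "'a::real_algebra_1 \<Rightarrow> 'a \<Rightarrow> 'a"
  where "boson_J0 a abar = (1/2) *\<^sub>R (a * abar + abar * a)"

definition realization :: "'a::real_algebra_1 \<Rightarrow> 'a \<Rightarrow> usl2 \<Rightarrow> 'a"
  where "realization a abar = alg_hom (\<lambda>g. case g of
      Plus_gen \<Rightarrow> boson_Jp a | Minus_gen \<Rightarrow> boson_Jm abar | Zero_gen \<Rightarrow> boson_J0 a abar)"

text \<open>\<open>ad X (t) = \<Sum> X\<^sub>(\<^sub>1\<^sub>) t S(X\<^sub>(\<^sub>2\<^sub>))\<close> for the twisted coproduct and the twisted antipode,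
  where elements of \<open>U(sl(2))\<close> act on operators through the boson realization.\<close>

definition ad :: "'a::real_algebra_1 \<Rightarrow> 'a \<Rightarrow> usl2 \<Rightarrow> 'a fps \<Rightarrow> 'a fps"
  where "ad a abar X t =
    hext (sweedler (\<lambda>x y. fps_const (realization a abar x) * t *
                         hext (\<lambda>z. fps_const (realization a abar z)) (twisted_antipode y)))
         (twisted_coproduct X)"

text \<open>
  \<open>j\<close> and \<open>m\<close> are (half-)integers, represented as reals; \<open>2j\<close>, \<open>j - m\<close> and \<open>j + m\<close> are natural
  numbers in the range \<open>- j \<le> m \<le> j\<close> in which the symplecton is defined.
\<close>

definition symplecton :: "'a::real_algebra_1 \<Rightarrow> 'a \<Rightarrow> real \<Rightarrow> real \<Rightarrow> 'a"
  where "symplecton a abar j m =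
    (let d = nat \<lfloor>2 * j\<rfloor>; p = nat \<lfloor>j - m\<rfloor>; q = nat \<lfloor>j + m\<rfloor> in
      (1 / 2 ^ p * sqrt (fact d * fact p / fact q)) *\<^sub>R
      (\<Sum>s\<le>p. (1 / (fact s * fact (p - s))) *\<^sub>R (abar ^ (p - s) * a ^ q * abar ^ s)))"

definition h_symplecton :: "'a::real_algebra_1 \<Rightarrow> 'a \<Rightarrow> real \<Rightarrow> real \<Rightarrow> 'a fps"
  where "h_symplecton a abar j m =
    fps_const (symplecton a abar j m) * hexp (hscale m (sigma (boson_Jp a)))"

end

(* Let x \<otimes> y in U(sl2) \<otimes> U(sl2) act on operators by w \<mapsto> x w S(y), write F.w for the
   action of the twist, and put U = F.1, which is the image of u.  Then the twisted adjoint action is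
   ad X (t) = F.([X, F^-1.(t U)]) U^-1 for primitive X, so that w \<mapsto> (F.w) U^-1 intertwines the
   ordinary commutator action with the twisted one.  If [J0, P] = 2 m P, then moving P to the left
   of all powers of J0 in F.P shows F.P = P U exp(-m S(sigma)), and U exp(-m S(sigma)) U^-1 =
   exp(m sigma).  Hence the intertwiner maps P to P exp(m sigma), and the claim reduces to the
   commutators of the sl(2) symplecton, which is a multiple of T^(j-m)(a^(j+m)) with
   T(x) = abar x + x abar. *)

theory Submission
  imports Defs
begin

section \<open>Power series over a noncommutative algebra\<close>

text \<open>Two obstacles shape the proof. The coefficients do not commute, so identities between
  series in J+ are proved over \<open>real\<close> and transported by \<open>hcalc\<close>, which
  sends a real series f to f(h x). And \<open>sweedler\<close> selects a value common to all
  decompositions of an element of \<open>usl2_tensor\<close>, which is given by generators and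
  relations without a basis; exhibiting each Sweedler sum as an action shows that the value is
  unique. The sign change in U exp(-m S(sigma)) U^-1 = exp(m sigma) comes from computing F.J+ in two
  ways, which gives U J+ = J+ U (1 + 2 h J+). Hence U (1 + 2 h J+) U^-1 = (1 - 2 h J+)^-1, and since
  S(sigma) = -ln(1 + 2 h J+), conjugation by U sends S(sigma) to -sigma. Only primitivity and
  weights of the generators enter, so J- is handled exactly like J+ and J0.\<close>

lemma of_real_mult_fps_commute: "fps_const (of_real c) * x = x * fps_const (of_real c)"
  for x :: "'a::real_algebra_1 fps"
  by (simp add: fps_eq_iff of_real_def)

lemma hscale_nth [simp]: "(hscale c x) $ n = c *\<^sub>R (x $ n)"
  by (simp add: of_real_def)

lemma hscale_mult_left: "hscale c x * y = hscale c (x * y)"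
  for x :: "'a::real_algebra_1 fps"
  by (simp add: mult.assoc)

lemma hscale_mult_right: "x * hscale c y = hscale c (x * y)"
  for x :: "'a::real_algebra_1 fps"
  by (metis mult.assoc of_real_mult_fps_commute)

lemma fps_power_nth_less:
  fixes x :: "'a::real_algebra_1 fps"
  assumes "x $ 0 = 0" and "n < k"
  shows "x ^ k $ n = 0"
  using assms(2)
proof (induction k arbitrary: n)
  case (Suc k)
  have "x $ i * x ^ k $ (n - i) = 0" if "i \<le> n" for i
    using Suc that assms(1) by (cases "i = 0") auto
  then show ?case by (simp add: fps_mult_nth)
qed simp

lemma fps_sandwich_power_nth_less:
  fixes x :: "'a::real_algebra_1 fps"
  assumes "x $ 0 = 0" and "n < k"
  shows "(a * x ^ k * b) $ n = 0"
proof -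
  have "(a * x ^ k) $ i = 0" if "i \<le> n" for i
    using that assms by (auto simp: fps_mult_nth fps_power_nth_less intro!: sum.neutral)
  then show ?thesis by (auto simp: fps_mult_nth intro!: sum.neutral)
qed

text \<open>Since \<open>x ^ i\<close> starts at order i, the defining sum may be cut at any bound
  from n on. A bound independent of the coefficient is what allows the sum to be exchanged with the
  convolutions.\<close>

lemma hsubst_sandwich_nth:
  fixes x :: "'a::real_algebra_1 fps"
  assumes x: "x $ 0 = 0" and N: "n \<le> N"
  shows "(a * hsubst f x * b) $ n = (\<Sum>i\<le>N. (f $ i) *\<^sub>R ((a * x ^ i * b) $ n))"
proof -
  have nth: "hsubst f x $ k = (\<Sum>i\<le>N. (f $ i) *\<^sub>R (x ^ i $ k))" if "k \<le> n" for k
  proof -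
    have zero: "i \<le> k" if "x ^ i $ k \<noteq> 0" for i
      using that fps_power_nth_less[OF x] by (meson not_le)
    show ?thesis
      unfolding hsubst_def using that N by (auto intro!: sum.mono_neutral_left dest: zero)
  qed
  have "(a * hsubst f x * b) $ n
      = (\<Sum>l=0..n. \<Sum>k=0..l. \<Sum>i\<le>N. (f $ i) *\<^sub>R (a $ k * x ^ i $ (l - k) * b $ (n - l)))"
    by (simp add: fps_mult_nth nth sum_distrib_left sum_distrib_right)
  also have "\<dots> = (\<Sum>i\<le>N. \<Sum>l=0..n. \<Sum>k=0..l. (f $ i) *\<^sub>R (a $ k * x ^ i $ (l - k) * b $ (n - l)))"
    by (simp add: sum.swap[of _ "{..N}"])
  finally show ?thesis
    by (simp add: fps_mult_nth scaleR_sum_right sum_distrib_right)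
qed

lemma hsubst_nth_0 [simp]: "hsubst f x $ 0 = of_real (f $ 0)"
  by (simp add: hsubst_def of_real_def)

lemma hsubst_conjugate:
  fixes x :: "'a::real_algebra_1 fps"
  assumes "x $ 0 = 0" and "u' * u = 1" and "u * u' = 1"
  shows "u * hsubst f x * u' = hsubst f (u * x * u')"
proof (rule fps_ext)
  fix n
  have power: "u * x ^ i * u' = (u * x * u') ^ i" for i
  proof (induction i)
    case (Suc i)
    have "u * x ^ Suc i * u' = u * x * (u' * u) * x ^ i * u'"
      using assms(2) by (simp add: mult.assoc)
    also have "\<dots> = (u * x * u') * (u * x ^ i * u')"
      by (simp add: mult.assoc)
    finally show ?case by (simp add: Suc)
  qed (simp add: assms)
  show "(u * hsubst f x * u') $ n = hsubst f (u * x * u') $ n"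
    unfolding hsubst_sandwich_nth[OF assms(1) order_refl] power by (simp add: hsubst_def)
qed

text \<open>Evaluation f(h x). The powers of a single \<open>x\<close> commute, so this is an
  algebra homomorphism and carries identities from \<open>real fps\<close> to noncommutative
  coefficients.\<close>

definition hcalc :: "'a::real_algebra_1 \<Rightarrow> real fps \<Rightarrow> 'a fps"
  where "hcalc x f = Abs_fps (\<lambda>n. (f $ n) *\<^sub>R x ^ n)"

lemma hcalc_nth [simp]: "hcalc x f $ n = (f $ n) *\<^sub>R x ^ n"
  by (simp add: hcalc_def)

lemma hcalc_add: "hcalc x (f + g) = hcalc x f + hcalc x g"
  and hcalc_diff: "hcalc x (f - g) = hcalc x f - hcalc x g"
  and hcalc_minus: "hcalc x (- f) = - hcalc x f"
  and hcalc_one [simp]: "hcalc x 1 = 1"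
  and hcalc_scale: "hcalc x (fps_const c * f) = hscale c (hcalc x f)"
  by (auto simp: fps_eq_iff scaleR_left.add scaleR_left.diff scaleR_left.minus of_real_def)

lemma hcalc_X: "hcalc x fps_X = hpar * fps_const x"
  by (auto simp: fps_eq_iff fps_X_def)

lemma hcalc_mult: "hcalc x (f * g) = hcalc x f * hcalc x g"
proof (rule fps_ext)
  fix n
  have "(\<Sum>i=0..n. (f $ i * g $ (n - i)) *\<^sub>R x ^ n)
      = (\<Sum>i=0..n. ((f $ i) *\<^sub>R x ^ i) * ((g $ (n - i)) *\<^sub>R x ^ (n - i)))"
  proof (rule sum.cong[OF HOL.refl])
    fix i assume "i \<in> {0..n}"
    then have "x ^ n = x ^ i * x ^ (n - i)"
      by (simp flip: power_add)
    then show "(f $ i * g $ (n - i)) *\<^sub>R x ^ n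
        = ((f $ i) *\<^sub>R x ^ i) * ((g $ (n - i)) *\<^sub>R x ^ (n - i))"
      by (simp add: mult.commute)
  qed
  then show "hcalc x (f * g) $ n = (hcalc x f * hcalc x g) $ n"
    by (simp add: fps_mult_nth scaleR_sum_left)
qed

lemma hcalc_power: "hcalc x (f ^ n) = hcalc x f ^ n"
  by (induction n) (simp_all add: hcalc_mult)

lemma hcalc_uminus: "hcalc (- x) f = hcalc x (f oo - fps_X)"
proof (rule fps_ext)
  show "hcalc (- x) f $ n = hcalc x (f oo - fps_X) $ n" for n
    by (cases "even n") (simp_all add: fps_compose_uminus')
qed

lemma hsubst_hcalc: "hsubst f (hcalc x g) = hcalc x (f oo g)"
  by (auto simp: fps_eq_iff hsubst_def fps_compose_nth atLeast0AtMost scaleR_sum_left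
      simp flip: hcalc_power)

section \<open>The scalar series of sigma and the substitution y = -X / (1 - 2 X)\<close>

definition sigma_fps :: "real fps"
  where "sigma_fps = - (fps_ln 1 oo (- 2 * fps_X))"

lemma sigma_fps_nth_0 [simp]: "sigma_fps $ 0 = 0"
  by (simp add: sigma_fps_def)

lemma sigma_eq_hcalc: "sigma x = hcalc x sigma_fps"
proof -
  have "1 - 2 * hpar * fps_const x - 1 = hcalc x (- 2 * fps_X)"
    by (auto simp: fps_eq_iff fps_X_def numeral_fps_const scaleR_conv_of_real)
  then show ?thesis
    by (simp only: sigma_def hln_def sigma_fps_def hcalc_minus hsubst_hcalc)
qed

lemma exp_minus_sigma_fps: "fps_exp 1 oo (- sigma_fps) = 1 - 2 * (fps_X :: real fps)"
proof -
  have "(fps_exp (1::real) - 1) oo fps_ln 1 = fps_X"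
    by (simp add: fps_ln_fps_exp_inv fps_inv_right)
  then have "fps_exp (1::real) oo fps_ln 1 = 1 + fps_X"
    by (simp add: fps_compose_sub_distrib diff_eq_eq add.commute)
  moreover have "fps_exp (1::real) oo (- sigma_fps)
      = (fps_exp 1 oo fps_ln 1) oo (- 2 * fps_X)"
    by (simp add: sigma_fps_def fps_compose_assoc)
  ultimately show ?thesis
    by (simp add: fps_compose_add_distrib)
qed

text \<open>Here 1 - 2 y = 1 / (1 - 2 X), so the logarithm changes sign. Both sides have constant
  term 0, hence it suffices to compare derivatives, each multiplied by 1 - 2 X to avoid
  division.\<close>

lemma sigma_fps_compose:
  fixes y :: "real fps"
  assumes y: "(1 - 2 * fps_X) * y = - fps_X"
  shows "sigma_fps oo y = - sigma_fps"
proof -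
  have y0: "y $ 0 = 0"
    using arg_cong[OF y, of "\<lambda>f. f $ 0"] by simp
  have deriv_sigma: "(1 - 2 * fps_X) * fps_deriv sigma_fps = 2"
  proof -
    have "(1 + fps_X) * fps_deriv (fps_ln (1::real)) = 1"
      by (simp add: fps_ln_deriv inverse_mult_eq_1')
    then have "((1 + fps_X) * fps_deriv (fps_ln (1::real))) oo (- 2 * fps_X) = 1"
      by simp
    then have "(1 - 2 * fps_X) * (fps_deriv (fps_ln (1::real)) oo (- 2 * fps_X)) = 1"
      by (simp add: fps_compose_mult_distrib fps_compose_add_distrib)
    then show ?thesis
      by (simp add: sigma_fps_def fps_compose_deriv mult.assoc[symmetric])
  qed
  have "((1 - 2 * fps_X) * fps_deriv sigma_fps) oo y = 2"
    by (simp add: deriv_sigma)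
  then have deriv_compose: "(1 - 2 * y) * (fps_deriv sigma_fps oo y) = 2"
    by (simp add: fps_compose_mult_distrib fps_compose_sub_distrib y0)
  have deriv_y: "(1 - 2 * fps_X) * fps_deriv y = - (1 - 2 * y)"
    using arg_cong[OF y, of fps_deriv] by (simp add: algebra_simps)
  have "(1 - 2 * fps_X) * fps_deriv (sigma_fps oo y)
      = (fps_deriv sigma_fps oo y) * ((1 - 2 * fps_X) * fps_deriv y)"
    by (simp add: fps_compose_deriv y0 mult_ac)
  also have "\<dots> = - ((1 - 2 * y) * (fps_deriv sigma_fps oo y))"
    by (simp only: deriv_y) (simp add: algebra_simps)
  also have "\<dots> = (1 - 2 * fps_X) * fps_deriv (- sigma_fps)"
    using deriv_sigma deriv_compose by simp
  finally have "(1 - 2 * fps_X) * fps_deriv (sigma_fps oo y) = (1 - 2 * fps_X) * fps_deriv (- sigma_fps)" .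
  moreover have "(1 - 2 * fps_X :: real fps) \<noteq> 0"
    by (metis deriv_sigma mult_zero_left zero_neq_numeral)
  ultimately have "fps_deriv (sigma_fps oo y) = fps_deriv (- sigma_fps)"
    by (simp only: mult_cancel_left) simp
  then show ?thesis
    unfolding fps_deriv_eq_iff by simp
qed

text \<open>This is the binomial series (1 - 2 X)^(-c).\<close>

definition exp_sigma :: "real \<Rightarrow> real fps"
  where "exp_sigma c = fps_exp 1 oo (fps_const c * sigma_fps)"

lemma hexp_sigma: "hexp (hscale c (sigma x)) = hcalc x (exp_sigma c)"
  by (simp add: hexp_def sigma_eq_hcalc exp_sigma_def hsubst_hcalc flip: hcalc_scale)

lemma exp_sigma_minus_one: "exp_sigma (- 1) = 1 - 2 * fps_X"
proof -
  have "fps_const (- 1) * sigma_fps = - sigma_fps"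
    by (simp add: fps_eq_iff)
  then show ?thesis
    by (simp only: exp_sigma_def exp_minus_sigma_fps)
qed

lemma exp_sigma_compose:
  assumes "(1 - 2 * fps_X) * y = - fps_X"
  shows "exp_sigma c oo y = exp_sigma (- c)"
proof -
  have y0: "y $ 0 = 0"
    using arg_cong[OF assms, of "\<lambda>f. f $ 0"] by simp
  have "exp_sigma c oo y = fps_exp 1 oo ((fps_const c * sigma_fps) oo y)"
    by (simp add: exp_sigma_def fps_compose_assoc y0)
  also have "(fps_const c * sigma_fps) oo y = fps_const (- c) * sigma_fps"
    by (simp add: fps_compose_mult_distrib y0 sigma_fps_compose[OF assms] flip: fps_const_neg)
  finally show ?thesis
    by (simp add: exp_sigma_def)
qed

section \<open>Exponentials acting by left and right multiplication\<close>

lemma add_power_commuting: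
  fixes x y :: "'a::ring_1"
  assumes "x * y = y * x"
  shows "(x + y) ^ n = (\<Sum>i\<le>n. of_nat (n choose i) * x ^ i * y ^ (n - i))"
proof (induction n)
  case (Suc n)
  let ?f = "\<lambda>n i. of_nat (n choose i) * x ^ i * y ^ (n - i)"
  have "x * ?f n i = of_nat (n choose i) * x ^ Suc i * y ^ (n - i)" for i
    by (metis mult.assoc mult_of_nat_commute power_Suc)
  moreover have "y * ?f n i = of_nat (n choose i) * x ^ i * y ^ (Suc n - i)" if "i \<le> n" for i
  proof -
    have "y * ?f n i = of_nat (n choose i) * (y * x ^ i) * y ^ (n - i)"
      by (metis mult.assoc mult_of_nat_commute)
    also have "y * x ^ i = x ^ i * y"
      using power_commuting_commutes[OF assms] by simp
    finally show ?thesis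
      using that by (simp add: Suc_diff_le mult.assoc)
  qed
  ultimately have "(x + y) ^ Suc n
      = (\<Sum>i\<le>n. of_nat (n choose i) * x ^ Suc i * y ^ (n - i))
        + (\<Sum>i\<le>n. of_nat (n choose i) * x ^ i * y ^ (Suc n - i))"
    unfolding power_Suc[of "x + y"] Suc semiring_class.distrib_right[of x y] sum_distrib_left
    by (simp only: sum.distrib[symmetric]) (intro sum.cong, auto)
  also have "(\<Sum>i\<le>n. of_nat (n choose i) * x ^ i * y ^ (Suc n - i))
      = (\<Sum>i\<le>Suc n. of_nat (n choose i) * x ^ i * y ^ (Suc n - i))"
    by (simp add: binomial_eq_0)
  also have "\<dots> = y ^ Suc n + (\<Sum>i\<le>n. of_nat (n choose Suc i) * x ^ Suc i * y ^ (n - i))"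
    by (subst sum.atMost_Suc_shift) simp
  also have "(\<Sum>i\<le>n. of_nat (n choose i) * x ^ Suc i * y ^ (n - i))
        + (y ^ Suc n + (\<Sum>i\<le>n. of_nat (n choose Suc i) * x ^ Suc i * y ^ (n - i)))
      = y ^ Suc n + (\<Sum>i\<le>n. ?f (Suc n) (Suc i))"
    by (simp add: sum.distrib semiring_class.distrib_right)
  also have "\<dots> = (\<Sum>i\<le>Suc n. ?f (Suc n) i)"
    by (subst sum.atMost_Suc_shift) simp
  finally show ?case .
qed simp

text \<open>This is how \<open>exp (K \<otimes> \<tau>)\<close> acts when \<open>x \<otimes> y\<close> acts by \<open>w \<mapsto> x w y\<close>.\<close>

definition exp_sandwich :: "'a::real_algebra_1 fps \<Rightarrow> 'a fps \<Rightarrow> 'a fps \<Rightarrow> 'a fps"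
  where "exp_sandwich K \<tau> w = Abs_fps (\<lambda>n. \<Sum>k\<le>n. (1 / fact k) *\<^sub>R ((K ^ k * w * \<tau> ^ k) $ n))"

text \<open>The same cut-off as in \<open>hsubst_sandwich_nth\<close>: term k starts at order k
  because \<open>\<tau>\<close> has no constant term.\<close>

lemma exp_sandwich_sandwich_nth:
  fixes K :: "'a::real_algebra_1 fps"
  assumes \<tau>: "\<tau> $ 0 = 0" and N: "n \<le> N"
  shows "(a * exp_sandwich K \<tau> w * b) $ n
      = (\<Sum>k\<le>N. (1 / fact k) *\<^sub>R ((a * (K ^ k * w * \<tau> ^ k) * b) $ n))"
proof -
  have nth: "exp_sandwich K \<tau> w $ k = (\<Sum>i\<le>N. (1 / fact i) *\<^sub>R ((K ^ i * w * \<tau> ^ i) $ k))"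
    if "k \<le> n" for k
  proof -
    have zero: "i \<le> k" if "(K ^ i * w * \<tau> ^ i) $ k \<noteq> 0" for i
      using fps_sandwich_power_nth_less[OF \<tau>, of k i "K ^ i * w" 1] that by (simp, meson not_le)
    show ?thesis
      unfolding exp_sandwich_def using that N by (auto intro!: sum.mono_neutral_left dest: zero)
  qed
  have "(a * exp_sandwich K \<tau> w * b) $ n
      = (\<Sum>l=0..n. \<Sum>k=0..l. \<Sum>i\<le>N.
          (1 / fact i) *\<^sub>R (a $ k * (K ^ i * w * \<tau> ^ i) $ (l - k) * b $ (n - l)))"
    by (simp add: fps_mult_nth[of _ b] fps_mult_nth[of a] nth sum_distrib_left sum_distrib_right)
  also have "\<dots> = (\<Sum>i\<le>N. \<Sum>l=0..n. \<Sum>k=0..l.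
          (1 / fact i) *\<^sub>R (a $ k * (K ^ i * w * \<tau> ^ i) $ (l - k) * b $ (n - l)))"
    by (simp add: sum.swap[of _ "{..N}"])
  finally show ?thesis
    by (simp add: fps_mult_nth[of _ b] fps_mult_nth[of a] scaleR_sum_right sum_distrib_right)
qed

lemma exp_sandwich_mult_right:
  assumes "\<tau> $ 0 = 0" and "c * \<tau> = \<tau> * c"
  shows "exp_sandwich K \<tau> (w * c) = exp_sandwich K \<tau> w * c"
proof (rule fps_ext)
  fix n
  have "w * (c * \<tau> ^ k) = w * (\<tau> ^ k * c)" for k
    using power_commuting_commutes[of \<tau> c k] assms(2) by simp
  then show "exp_sandwich K \<tau> (w * c) $ n = (exp_sandwich K \<tau> w * c) $ n"
    using exp_sandwich_sandwich_nth[OF assms(1) order_refl, of 1 K w c n]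
    by (simp add: exp_sandwich_def mult.assoc)
qed

text \<open>Moving \<open>p\<close> through \<open>K ^ k\<close> turns each \<open>K\<close> into
  \<open>L\<close>. For a weight vector \<open>p\<close>, \<open>L\<close> is \<open>K\<close> plus
  a scalar.\<close>

lemma exp_sandwich_mult_left:
  assumes "\<tau> $ 0 = 0" and "K * p = p * L"
  shows "exp_sandwich K \<tau> (p * w) = p * exp_sandwich L \<tau> w"
proof (rule fps_ext)
  fix n
  have "K ^ k * p = p * L ^ k" for k
    by (induction k) (simp_all add: mult.assoc assms(2), metis assms(2) mult.assoc)
  then have "K ^ k * (p * (w * \<tau> ^ k)) = p * (L ^ k * (w * \<tau> ^ k))" for k
    by (metis mult.assoc)
  then show "exp_sandwich K \<tau> (p * w) $ n = (p * exp_sandwich L \<tau> w) $ n"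
    using exp_sandwich_sandwich_nth[OF assms(1) order_refl, of p L w 1 n]
    by (simp add: exp_sandwich_def mult.assoc)
qed

text \<open>The maps taking w to K w \<tau> and to c w \<tau> commute, so the exponential of their
  sum splits; the proof is the Cauchy product of the two series.\<close>

lemma exp_sandwich_add_scalar:
  fixes K :: "'a::real_algebra_1 fps"
  assumes \<tau>: "\<tau> $ 0 = 0"
  shows "exp_sandwich (K + fps_const (of_real c)) \<tau> 1 = exp_sandwich K \<tau> 1 * hexp (hscale c \<tau>)"
proof (rule fps_ext)
  fix n
  let ?c = "fps_const (of_real c) :: 'a fps"
  \<comment> \<open>In the double series i factors come from \<open>K\<close> and r from the scalar;
    each of them brings one \<open>\<tau>\<close>.\<close>
  define t where "t i r = (c ^ r / (fact i * fact r)) *\<^sub>R ((K ^ i * \<tau> ^ (i + r)) $ n)" for i r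
  have t_0: "i + r \<le> n" if "t i r \<noteq> 0" for i r
  proof (rule ccontr)
    assume "\<not> i + r \<le> n"
    then have "(K ^ i * \<tau> ^ (i + r) * 1) $ n = 0"
      by (intro fps_sandwich_power_nth_less[OF \<tau>]) simp
    with that show False
      by (simp add: t_def)
  qed
  have binomial: "(1 / fact k) *\<^sub>R (((K + ?c) ^ k * \<tau> ^ k) $ n) = (\<Sum>i\<le>k. t i (k - i))" for k
  proof -
    have "((K + ?c) ^ k * \<tau> ^ k) $ n
        = (\<Sum>i\<le>k. (of_nat (k choose i) * K ^ i * ?c ^ (k - i) * \<tau> ^ k) $ n)"
      unfolding add_power_commuting[OF of_real_mult_fps_commute[of c K, symmetric]]
      by (simp add: sum_distrib_right fps_sum_nth)
    also have "\<dots> = (\<Sum>i\<le>k. (real (k choose i) * c ^ (k - i)) *\<^sub>R ((K ^ i * \<tau> ^ k) $ n))"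
    proof (intro sum.cong HOL.refl)
      fix i
      have "of_nat (k choose i) * K ^ i * ?c ^ (k - i) * \<tau> ^ k
          = hscale (real (k choose i) * c ^ (k - i)) (K ^ i * \<tau> ^ k)"
      proof -
        have "of_nat (k choose i) = (fps_const (of_real (real (k choose i))) :: 'a fps)"
          by (simp add: fps_of_nat)
        moreover have "?c ^ (k - i) = fps_const (of_real (c ^ (k - i)))"
          by simp
        moreover have "hscale a (K ^ i) * fps_const (of_real b) * \<tau> ^ k
            = hscale (a * b) (K ^ i * \<tau> ^ k)" for a b
        proof -
          have "hscale a (K ^ i) * fps_const (of_real b) * \<tau> ^ k
              = fps_const (of_real a) * (K ^ i * fps_const (of_real b)) * \<tau> ^ k"
            by (simp only: mult.assoc)
          also have "K ^ i * fps_const (of_real b) = hscale b (K ^ i)"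
            by (rule of_real_mult_fps_commute[symmetric])
          also have "hscale a (hscale b (K ^ i)) * \<tau> ^ k = hscale (a * b) (K ^ i * \<tau> ^ k)"
            by (simp flip: mult.assoc)
          finally show ?thesis .
        qed
        ultimately show ?thesis
          by (simp only:)
      qed
      then show "(of_nat (k choose i) * K ^ i * ?c ^ (k - i) * \<tau> ^ k) $ n
          = (real (k choose i) * c ^ (k - i)) *\<^sub>R ((K ^ i * \<tau> ^ k) $ n)"
        by (simp only: hscale_nth)
    qed
    finally show ?thesis
      by (auto simp: t_def scaleR_sum_right binomial_fact intro!: sum.cong)
  qed
  have "exp_sandwich (K + ?c) \<tau> 1 $ n = (\<Sum>k\<le>n. \<Sum>i\<le>k. t i (k - i))"
    by (simp add: exp_sandwich_def binomial)
  also have "\<dots> = (\<Sum>(i, r)\<in>{(i, r). i + r \<le> n}. t i r)"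
    by (rule sum.triangle_reindex_eq[symmetric])
  \<comment> \<open>Terms outside the triangle have order above n in h and vanish, so the square may
    replace it.\<close>
  also have "\<dots> = (\<Sum>(i, r)\<in>{..n} \<times> {..n}. t i r)"
    by (rule sum.mono_neutral_left) (auto dest: t_0)
  also have "\<dots> = (\<Sum>i\<le>n. \<Sum>r\<le>n. t i r)"
    by (rule sum.cartesian_product[symmetric])
  also have "\<dots> = (exp_sandwich K \<tau> 1 * hexp (hscale c \<tau>)) $ n"
  proof -
    have "(K ^ i * \<tau> ^ i * hexp (hscale c \<tau>)) $ n
        = (\<Sum>r\<le>n. (c ^ r / fact r) *\<^sub>R ((K ^ i * \<tau> ^ (i + r)) $ n))" for i
    proof -
      have "hscale c \<tau> ^ r = hscale (c ^ r) (\<tau> ^ r)" for r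
      proof (induction r)
        case (Suc r)
        have "hscale c \<tau> ^ Suc r = hscale c (\<tau> * hscale (c ^ r) (\<tau> ^ r))"
          by (simp only: power_Suc Suc hscale_mult_left)
        also have "\<dots> = hscale (c ^ Suc r) (\<tau> ^ Suc r)"
          by (subst hscale_mult_right) (simp flip: mult.assoc)
        finally show ?case .
      qed simp
      then have power: "(K ^ i * \<tau> ^ i * hscale c \<tau> ^ r * 1) $ n
          = c ^ r *\<^sub>R ((K ^ i * \<tau> ^ (i + r)) $ n)" for r
        by (simp only: hscale_mult_right mult_1_right hscale_nth power_add mult.assoc)
      have "(K ^ i * \<tau> ^ i * hexp (hscale c \<tau>) * 1) $ n
          = (\<Sum>r\<le>n. (fps_exp 1 $ r) *\<^sub>R (c ^ r *\<^sub>R ((K ^ i * \<tau> ^ (i + r)) $ n)))"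
        unfolding hexp_def power[symmetric]
        by (rule hsubst_sandwich_nth) (simp_all add: \<tau>)
      then show ?thesis
        by simp
    qed
    then show ?thesis
      using exp_sandwich_sandwich_nth[OF \<tau> order_refl, of 1 K 1 "hexp (hscale c \<tau>)" n]
      by (simp add: t_def scaleR_sum_right)
  qed
  finally show "exp_sandwich (K + ?c) \<tau> 1 $ n = (exp_sandwich K \<tau> 1 * hexp (hscale c \<tau>)) $ n" .
qed

section \<open>Presented algebras and their tensor product\<close>

locale algebra_hom =
  fixes \<phi> :: "'a::real_algebra_1 \<Rightarrow> 'b::real_algebra_1"
  assumes add: "\<phi> (x + y) = \<phi> x + \<phi> y"
    and mult: "\<phi> (x * y) = \<phi> x * \<phi> y"
    and of_real: "\<phi> (of_real c) = of_real c"
begin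

lemma one: "\<phi> 1 = 1"
  using of_real[of 1] by simp

lemma zero: "\<phi> 0 = 0"
  using of_real[of 0] by simp

lemma minus: "\<phi> (- x) = - \<phi> x"
  using add[of x "- x"] by (simp add: zero add_eq_0_iff)

lemma scaleR: "\<phi> (c *\<^sub>R x) = c *\<^sub>R \<phi> x"
  using mult[of "of_real c" x] of_real[of c] by (simp add: of_real_def)

end

locale algebra_antihom =
  fixes \<phi> :: "'a::real_algebra_1 \<Rightarrow> 'b::real_algebra_1"
  assumes add: "\<phi> (x + y) = \<phi> x + \<phi> y"
    and mult: "\<phi> (x * y) = \<phi> y * \<phi> x"
    and of_real: "\<phi> (of_real c) = of_real c"
begin

lemma one: "\<phi> 1 = 1"
  using of_real[of 1] by simp

lemma zero: "\<phi> 0 = 0"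
  using of_real[of 0] by simp

lemma minus: "\<phi> (- x) = - \<phi> x"
  using add[of x "- x"] by (simp add: zero add_eq_0_iff)

lemma power: "\<phi> (x ^ n) = \<phi> x ^ n"
  by (induction n) (simp_all add: one mult power_commutes)

lemma scaleR: "\<phi> (c *\<^sub>R x) = c *\<^sub>R \<phi> x"
  using mult[of "of_real c" x] of_real[of c] by (simp add: of_real_def)

end

lemma alg_eq_term_eval:
  assumes "\<And>s t. alg_rel s t \<Longrightarrow> term_eval f s = term_eval f t"
  shows "alg_eq s t \<Longrightarrow> term_eval f s = term_eval f t"
  by (induction rule: alg_eq.induct) (auto simp: assms of_real_def scaleR_left_distrib algebra_simps)

lemma alg_eq_term_anti_eval:
  assumes "\<And>s t. alg_rel s t \<Longrightarrow> term_anti_eval f s = term_anti_eval f t"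
  shows "alg_eq s t \<Longrightarrow> term_anti_eval f s = term_anti_eval f t"
  by (induction rule: alg_eq.induct) (auto simp: assms of_real_def scaleR_left_distrib algebra_simps)

lemma alg_eq_rep_abs_presented: "alg_eq (rep_presented (abs_presented s)) s"
  using Quotient3_rep_abs[OF Quotient3_presented] alg_eq.refl by blast

lemma abs_rep_presented: "abs_presented (rep_presented x) = x"
  by (rule Quotient3_abs_rep[OF Quotient3_presented])

lemma of_real_presented: "of_real c = abs_presented (Scal c)"
proof -
  have "c *\<^sub>R abs_presented (Scal 1) = abs_presented (Times (Scal c) (Scal 1))"
    by (rule scaleR_presented.abs_eq)
  also have "\<dots> = abs_presented (Scal (c * 1))"
    by (simp only: presented.abs_eq_iff) (rule alg_eq.sym, rule alg_eq.scal_times)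
  finally show ?thesis
    by (simp add: of_real_def one_presented_def)
qed

lemma presented_induct [case_names gen of_real plus times]:
  assumes "\<And>g. P (gen g)" and "\<And>c. P (of_real c)"
    and "\<And>x y. P x \<Longrightarrow> P y \<Longrightarrow> P (x + y)" and "\<And>x y. P x \<Longrightarrow> P y \<Longrightarrow> P (x * y)"
  shows "P x"
proof -
  have "P (abs_presented s)" for s
  proof (induction s)
    case (Gen g)
    then show ?case using assms(1) by (simp add: gen_def)
  next
    case (Scal c)
    then show ?case using assms(2) by (simp add: of_real_presented)
  next
    case (Plus s t)
    then show ?case using assms(3) by (simp flip: plus_presented.abs_eq)
  next
    case (Times s t)
    then show ?case using assms(4) by (simp flip: times_presented.abs_eq)
  qed
  then show ?thesis
    using abs_rep_presented by metis
qed

text \<open>Universal property of the presentation: the prescribed values respect the relations, so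
  the representative chosen in \<open>alg_hom\<close> is immaterial.\<close>

lemma algebra_hom_alg_hom:
  assumes "\<And>s t. alg_rel s t \<Longrightarrow> term_eval f s = term_eval f t"
  shows "algebra_hom (alg_hom f)" and "alg_hom f (gen g) = f g"
proof -
  have abs: "alg_hom f (abs_presented s) = term_eval f s" for s
    unfolding alg_hom_def by (rule alg_eq_term_eval[OF assms alg_eq_rep_abs_presented])
  show "alg_hom f (gen g) = f g"
    by (simp add: gen_def abs)
  show "algebra_hom (alg_hom f)"
  proof
    fix x y :: "'a presented" and c
    obtain s t where st: "x = abs_presented s" "y = abs_presented t"
      using abs_rep_presented by metis
    show "alg_hom f (x + y) = alg_hom f x + alg_hom f y"
      by (simp add: st abs plus_presented.abs_eq)
    show "alg_hom f (x * y) = alg_hom f x * alg_hom f y"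
      by (simp add: st abs times_presented.abs_eq)
    show "alg_hom f (of_real c) = of_real c"
      by (simp add: of_real_presented abs)
  qed
qed

lemma algebra_antihom_alg_antihom:
  assumes "\<And>s t. alg_rel s t \<Longrightarrow> term_anti_eval f s = term_anti_eval f t"
  shows "algebra_antihom (alg_antihom f)" and "alg_antihom f (gen g) = f g"
proof -
  have abs: "alg_antihom f (abs_presented s) = term_anti_eval f s" for s
    unfolding alg_antihom_def by (rule alg_eq_term_anti_eval[OF assms alg_eq_rep_abs_presented])
  show "alg_antihom f (gen g) = f g"
    by (simp add: gen_def abs)
  show "algebra_antihom (alg_antihom f)"
  proof
    fix x y :: "'a presented" and c
    obtain s t where st: "x = abs_presented s" "y = abs_presented t"
      using abs_rep_presented by metis
    show "alg_antihom f (x + y) = alg_antihom f x + alg_antihom f y"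
      by (simp add: st abs plus_presented.abs_eq)
    show "alg_antihom f (x * y) = alg_antihom f y * alg_antihom f x"
      by (simp add: st abs times_presented.abs_eq)
    show "alg_antihom f (of_real c) = of_real c"
      by (simp add: of_real_presented abs)
  qed
qed

lemma alg_rel_presented: "alg_rel s t \<Longrightarrow> abs_presented s = abs_presented t"
  by (simp add: presented.abs_eq_iff alg_eq.rel)

lemma term_eval_gen: "term_eval (\<lambda>g. gen (f g)) s = abs_presented (map_alg_term f s)"
  by (induction s)
    (simp_all add: gen_def of_real_presented plus_presented.abs_eq times_presented.abs_eq)

lemma alg_rel_sumI:
  "alg_rel s t \<Longrightarrow> alg_rel (map_alg_term Inl s) (map_alg_term Inl t)"
  "alg_rel s t \<Longrightarrow> alg_rel (map_alg_term Inr s) (map_alg_term Inr t)"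
  "alg_rel (Times (Gen (Inl x)) (Gen (Inr y))) (Times (Gen (Inr y)) (Gen (Inl x)))"
  by (rule alg_rel_sum.intros; assumption?)+

section \<open>Tensor square of U(sl(2)) and Sweedler sums\<close>

abbreviation tensor_left :: "usl2 \<Rightarrow> usl2_tensor"
  where "tensor_left \<equiv> alg_hom (\<lambda>g. gen (Inl g))"

abbreviation tensor_right :: "usl2 \<Rightarrow> usl2_tensor"
  where "tensor_right \<equiv> alg_hom (\<lambda>g. gen (Inr g))"

lemma tensor_left_rel:
  "alg_rel s t \<Longrightarrow> term_eval (\<lambda>g. gen (Inl g)) s = (term_eval (\<lambda>g. gen (Inl g)) t :: usl2_tensor)"
  unfolding term_eval_gen by (intro alg_rel_presented alg_rel_sumI)

lemma tensor_right_rel: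
  "alg_rel s t \<Longrightarrow> term_eval (\<lambda>g. gen (Inr g)) s = (term_eval (\<lambda>g. gen (Inr g)) t :: usl2_tensor)"
  unfolding term_eval_gen by (intro alg_rel_presented alg_rel_sumI)

interpretation tensor_left: algebra_hom tensor_left
  by (rule algebra_hom_alg_hom(1)[OF tensor_left_rel])

interpretation tensor_right: algebra_hom tensor_right
  by (rule algebra_hom_alg_hom(1)[OF tensor_right_rel])

lemma tensor_left_gen [simp]: "tensor_left (gen g) = gen (Inl g)"
  by (rule algebra_hom_alg_hom(2)[OF tensor_left_rel])

lemma tensor_right_gen [simp]: "tensor_right (gen g) = gen (Inr g)"
  by (rule algebra_hom_alg_hom(2)[OF tensor_right_rel])

lemma tensor_left_right_commute: "tensor_left x * tensor_right y = tensor_right y * tensor_left x"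
proof (induction x rule: presented_induct)
  case (gen g)
  show ?case
  proof (induction y rule: presented_induct)
    case (gen g')
    have "gen (Inl g) * gen (Inr g') = (gen (Inr g') * gen (Inl g) :: usl2_tensor)"
      by (simp add: gen_def times_presented.abs_eq alg_rel_presented[OF alg_rel_sumI(3)])
    then show ?case by simp
  next
    case (times x y)
    then show ?case by (simp add: tensor_right.mult flip: mult.assoc) (simp add: mult.assoc)
  qed (simp_all add: tensor_right.add tensor_right.of_real algebra_simps, simp add: of_real_def)
next
  case (times x y)
  then show ?case by (simp add: tensor_left.mult mult.assoc) (simp flip: mult.assoc)
qed (simp_all add: tensor_left.add tensor_left.of_real algebra_simps, simp add: of_real_def)

lemma tensor_mult: "(x \<otimes> y) * (x' \<otimes> y') = (x * x') \<otimes> (y * y')"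
proof -
  have "tensor_right y * (tensor_left x' * tensor_right y')
      = tensor_left x' * (tensor_right y * tensor_right y')"
    by (simp add: tensor_left_right_commute[of x' y] flip: mult.assoc)
  then show ?thesis
    by (simp add: tensor_def tensor_left.mult tensor_right.mult mult.assoc)
qed

lemma tensor_gen: "gen (Inl g) = gen g \<otimes> 1" "gen (Inr g) = 1 \<otimes> gen g"
  by (simp_all add: tensor_def tensor_left.one tensor_right.one)

lemma tensor_of_real: "of_real c = of_real c \<otimes> 1"
  by (simp add: tensor_def tensor_left.of_real tensor_right.one)

text \<open>Existence half for the \<open>THE\<close> in \<open>sweedler\<close>;
  \<open>sweedler_eq\<close> supplies uniqueness.\<close>

lemma tensor_span: "\<exists>ps. v = (\<Sum>(x, y)\<leftarrow>ps. x \<otimes> y)"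
proof (induction v rule: presented_induct)
  case (gen g)
  have "\<exists>x y. gen g = x \<otimes> y"
    by (cases g) (auto simp: tensor_gen)
  then obtain x y where "gen g = x \<otimes> y" by blast
  then show ?case by (intro exI[of _ "[(x, y)]"]) simp
next
  case (of_real c)
  then show ?case by (intro exI[of _ "[(of_real c, 1)]"]) (simp add: tensor_of_real)
next
  case (plus v w)
  then obtain ps qs where "v = (\<Sum>(x, y)\<leftarrow>ps. x \<otimes> y)" "w = (\<Sum>(x, y)\<leftarrow>qs. x \<otimes> y)" by blast
  then show ?case by (intro exI[of _ "ps @ qs"]) simp
next
  case (times v w)
  then obtain ps qs where v: "v = (\<Sum>(x, y)\<leftarrow>ps. x \<otimes> y)" and w: "w = (\<Sum>(x, y)\<leftarrow>qs. x \<otimes> y)" by blast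
  have row: "(x \<otimes> y) * (\<Sum>(x', y')\<leftarrow>qs. x' \<otimes> y')
      = (\<Sum>(x, y)\<leftarrow>map (\<lambda>(x', y'). (x * x', y * y')) qs. x \<otimes> y)" for x y qs
    by (induction qs) (auto simp: semiring_class.distrib_left tensor_mult)
  have "v * w = (\<Sum>(x, y)\<leftarrow>concat (map (\<lambda>(x, y). map (\<lambda>(x', y'). (x * x', y * y')) qs) ps). x \<otimes> y)"
    unfolding v by (induction ps) (auto simp: semiring_class.distrib_right row w)
  then show ?case by blast
qed

text \<open>An additive map through which \<open>\<beta>\<close> factors gives the same value on
  every decomposition, so uniqueness follows without deciding when two sums of pure tensors
  agree.\<close>

lemma sweedler_eq:
  assumes \<beta>: "\<And>x y. \<beta> x y = \<Lambda> (x \<otimes> y)"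
    and add: "\<And>v w. \<Lambda> (v + w) = \<Lambda> v + \<Lambda> w" and zero: "\<Lambda> 0 = 0"
  shows "sweedler \<beta> v = \<Lambda> v"
proof -
  have sum: "(\<Sum>(x, y)\<leftarrow>ps. \<beta> x y) = \<Lambda> (\<Sum>(x, y)\<leftarrow>ps. x \<otimes> y)" for ps
    by (induction ps) (auto simp: \<beta> add zero)
  obtain ps where ps: "v = (\<Sum>(x, y)\<leftarrow>ps. x \<otimes> y)"
    using tensor_span by blast
  show ?thesis
    unfolding sweedler_def
  proof (rule the_equality)
    show "\<exists>ps. v = (\<Sum>(x, y)\<leftarrow>ps. x \<otimes> y) \<and> \<Lambda> v = (\<Sum>(x, y)\<leftarrow>ps. \<beta> x y)"
      using ps sum[of ps] by (intro exI[of _ ps]) simp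
  next
    fix w
    assume "\<exists>ps. v = (\<Sum>(x, y)\<leftarrow>ps. x \<otimes> y) \<and> w = (\<Sum>(x, y)\<leftarrow>ps. \<beta> x y)"
    then obtain qs where "v = (\<Sum>(x, y)\<leftarrow>qs. x \<otimes> y)" "w = (\<Sum>(x, y)\<leftarrow>qs. \<beta> x y)"
      by (elim exE conjE)
    then show "w = \<Lambda> v"
      by (simp only: sum)
  qed
qed

lemma hext_const:
  assumes "\<phi> 0 = 0"
  shows "hext (\<lambda>x. fps_const (\<phi> x)) f = Abs_fps (\<lambda>n. \<phi> (f $ n))"
proof (rule fps_ext)
  fix n
  have "hext (\<lambda>x. fps_const (\<phi> x)) f $ n = (\<Sum>i\<le>n. if i = n then \<phi> (f $ n) else 0)"
    by (simp add: hext_def)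
  then show "hext (\<lambda>x. fps_const (\<phi> x)) f $ n = Abs_fps (\<lambda>n. \<phi> (f $ n)) $ n"
    by simp
qed

text \<open>
  Letting \<open>x \<otimes> y\<close> act by \<open>c \<mapsto> lam(x) c rho(y)\<close> respects the relations of the tensor product.
  All Sweedler sums in the definitions are values of such an action, which makes them independent of
  the chosen decomposition.
\<close>

locale tensor_action = lam: algebra_hom lam + rho: algebra_antihom rho
  for lam rho :: "usl2 \<Rightarrow> 'a::real_algebra_1"
begin

text \<open>\<open>alg_hom\<close> requires a target type of class \<open>real_algebra_1\<close>,
  whereas operators on \<open>'a\<close> are plain functions. The action is therefore defined on
  terms and shown to respect \<open>alg_eq\<close>.\<close>

primrec act_term :: "(sl2_gen + sl2_gen) alg_term \<Rightarrow> 'a \<Rightarrow> 'a" where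
  "act_term (Gen g) = (\<lambda>c. case g of Inl x \<Rightarrow> lam (gen x) * c | Inr y \<Rightarrow> c * rho (gen y))"
| "act_term (Scal k) = (\<lambda>c. k *\<^sub>R c)"
| "act_term (Plus s t) = (\<lambda>c. act_term s c + act_term t c)"
| "act_term (Times s t) = (\<lambda>c. act_term s (act_term t c))"

lemma act_term_add: "act_term s (c + d) = act_term s c + act_term s d"
  by (induction s arbitrary: c d) (auto simp: algebra_simps split: sum.split)

lemma act_term_scaleR: "act_term s (k *\<^sub>R c) = k *\<^sub>R act_term s c"
  by (induction s arbitrary: c) (auto simp: algebra_simps split: sum.split)

lemma act_term_Inl: "act_term (map_alg_term Inl s) c = lam (abs_presented s) * c"
  by (induction s arbitrary: c)
    (simp_all add: gen_def lam.of_real lam.add lam.mult algebra_simps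
      flip: of_real_presented plus_presented.abs_eq times_presented.abs_eq, simp add: of_real_def)

text \<open>Right multiplication reverses products and \<open>rho\<close> reverses them again, so
  the second leg too acts as a left module.\<close>

lemma act_term_Inr: "act_term (map_alg_term Inr s) c = c * rho (abs_presented s)"
  by (induction s arbitrary: c)
    (simp_all add: gen_def rho.of_real rho.add rho.mult algebra_simps
      flip: of_real_presented plus_presented.abs_eq times_presented.abs_eq, simp add: of_real_def)

text \<open>The mixed relation amounts to associativity: left and right multiplications
  commute.\<close>

lemma act_term_rel: "alg_rel s t \<Longrightarrow> act_term s c = act_term t c"
  by (induction rule: alg_rel_sum.induct)
    (simp_all add: act_term_Inl act_term_Inr alg_rel_presented mult.assoc)

lemma act_term_eq: "alg_eq s t \<Longrightarrow> act_term s c = act_term t c"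
  by (induction arbitrary: c rule: alg_eq.induct)
    (simp_all add: act_term_rel act_term_add act_term_scaleR algebra_simps)

definition act :: "usl2_tensor \<Rightarrow> 'a \<Rightarrow> 'a"
  where "act v = act_term (rep_presented v)"

lemma act_abs: "act (abs_presented s) c = act_term s c"
  unfolding act_def by (rule act_term_eq[OF alg_eq_rep_abs_presented])

lemma act_add: "act (v + w) c = act v c + act w c"
  and act_mult: "act (v * w) c = act v (act w c)"
proof -
  obtain s t where st: "v = abs_presented s" "w = abs_presented t"
    using abs_rep_presented by metis
  show "act (v + w) c = act v c + act w c" "act (v * w) c = act v (act w c)"
    by (simp_all add: st act_abs plus_presented.abs_eq times_presented.abs_eq)
qed

lemma act_of_real: "act (of_real k) c = k *\<^sub>R c"
  by (simp add: of_real_presented act_abs)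

lemma act_add_right: "act v (c + d) = act v c + act v d"
  by (simp add: act_def act_term_add)

lemma act_scaleR_right: "act v (k *\<^sub>R c) = k *\<^sub>R act v c"
  by (simp add: act_def act_term_scaleR)

lemma act_zero [simp]: "act 0 c = 0"
  using act_of_real[of 0 c] by simp

lemma act_one [simp]: "act 1 c = c"
  using act_of_real[of 1 c] by simp

lemma act_scaleR: "act (k *\<^sub>R v) c = k *\<^sub>R act v c"
  using act_mult[of "of_real k" v c] by (simp add: act_of_real) (simp add: of_real_def)

lemma act_zero_right [simp]: "act v 0 = 0"
  using act_scaleR_right[of v 0 0] by simp

lemma act_sum: "act (sum f A) c = (\<Sum>i\<in>A. act (f i) c)"
  by (induction A rule: infinite_finite_induct) (simp_all add: act_add)

lemma act_sum_right: "act v (sum f A) = (\<Sum>i\<in>A. act v (f i))"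
  by (induction A rule: infinite_finite_induct) (simp_all add: act_add_right)

lemma act_gen [simp]:
  "act (gen (Inl g)) c = lam (gen g) * c" "act (gen (Inr g)) c = c * rho (gen g)"
  using act_abs[of "Gen (Inl g)" c] act_abs[of "Gen (Inr g)" c] by (simp_all flip: gen.abs_eq)

lemma act_tensor: "act (x \<otimes> y) c = lam x * c * rho y"
proof -
  have left: "act (tensor_left x) c = lam x * c" for c
    by (induction x arbitrary: c rule: presented_induct)
      (simp_all add: act_add act_mult act_of_real tensor_left.add tensor_left.mult tensor_left.of_real
        lam.add lam.mult lam.of_real algebra_simps, simp add: of_real_def)
  have right: "act (tensor_right y) c = c * rho y" for c
    by (induction y arbitrary: c rule: presented_induct)
      (simp_all add: act_add act_mult act_of_real tensor_right.add tensor_right.mult tensor_right.of_real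
        rho.add rho.mult rho.of_real algebra_simps, simp add: of_real_def)
  show ?thesis
    by (simp add: tensor_def act_mult left right mult.assoc)
qed

definition hact :: "usl2_tensor fps \<Rightarrow> 'a fps \<Rightarrow> 'a fps"
  where "hact v w = hext (\<lambda>x. Abs_fps (\<lambda>n. act x (w $ n))) v"

lemma hact_nth: "hact v w $ n = (\<Sum>i=0..n. act (v $ i) (w $ (n - i)))"
  by (simp add: hact_def hext_def atLeast0AtMost)

lemma hact_mult: "hact (v * v') w = hact v (hact v' w)"
proof (rule fps_ext)
  fix n
  have "hact (v * v') w $ n
      = (\<Sum>j=0..n. \<Sum>i=0..j. act (v $ i) (act (v' $ (j - i)) (w $ (n - j))))"
    by (simp add: hact_nth fps_mult_nth act_sum act_mult)
  also have "\<dots> = (\<Sum>j=0..n. \<Sum>i=0..n - j. act (v $ j) (act (v' $ i) (w $ (n - j - i))))"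
    by (rule fps_mult_assoc_lemma)
  also have "\<dots> = hact v (hact v' w) $ n"
    by (simp add: hact_nth act_sum_right)
  finally show "hact (v * v') w $ n = hact v (hact v' w) $ n" .
qed

lemma hact_const: "hact (fps_const v) w = Abs_fps (\<lambda>n. act v (w $ n))"
proof (rule fps_ext)
  fix n
  have "hact (fps_const v) w $ n = (\<Sum>i=0..n. if i = 0 then act v (w $ n) else 0)"
    unfolding hact_nth by (intro sum.cong) auto
  then show "hact (fps_const v) w $ n = Abs_fps (\<lambda>n. act v (w $ n)) $ n" by simp
qed

lemma hact_one [simp]: "hact 1 w = w"
  using hact_const[of 1 w] by (simp add: fps_eq_iff flip: fps_const_1_eq_1)

lemma hact_const_tensor: "hact (fps_const (x \<otimes> y)) w = fps_const (lam x) * w * fps_const (rho y)"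
  by (simp add: hact_const act_tensor fps_eq_iff)

lemma hact_hext_tensor:
  "hact (hext (\<lambda>y. fps_const (x \<otimes> y)) f) w = fps_const (lam x) * w * Abs_fps (\<lambda>n. rho (f $ n))"
proof (rule fps_ext)
  fix n
  have "hact (hext (\<lambda>y. fps_const (x \<otimes> y)) f) w $ n
      = (\<Sum>i=0..n. lam x * w $ (n - i) * rho (f $ i))"
    by (simp add: hext_const tensor_def tensor_right.zero hact_nth act_tensor[unfolded tensor_def])
  also have "\<dots> = (\<Sum>i=0..n. lam x * w $ i * rho (f $ (n - i)))"
    by (subst sum.atLeastAtMost_rev) simp
  finally show "hact (hext (\<lambda>y. fps_const (x \<otimes> y)) f) w $ n
      = (fps_const (lam x) * w * Abs_fps (\<lambda>n. rho (f $ n))) $ n"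
    by (simp add: fps_mult_nth[of _ "Abs_fps _"])
qed

lemma hact_hscale: "hact (hscale c v) w = hscale c (hact v w)"
  by (simp add: fps_eq_iff hact_nth of_real_def act_scaleR scaleR_sum_right)

lemma hact_hsubst_nth:
  assumes "z $ 0 = 0"
  shows "hact (hsubst f z) w $ n = (\<Sum>k\<le>n. (f $ k) *\<^sub>R (hact (z ^ k) w $ n))"
proof -
  have "hact (hsubst f z) w $ n
      = (\<Sum>i=0..n. \<Sum>k\<le>n. (f $ k) *\<^sub>R act (z ^ k $ i) (w $ (n - i)))"
  proof -
    have "hsubst f z $ i = (\<Sum>k\<le>n. (f $ k) *\<^sub>R (z ^ k $ i))" if "i \<le> n" for i
      using hsubst_sandwich_nth[OF assms that, of 1 f 1] by simp
    then show ?thesis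
      by (simp add: hact_nth act_sum act_scaleR)
  qed
  also have "\<dots> = (\<Sum>k\<le>n. \<Sum>i=0..n. (f $ k) *\<^sub>R act (z ^ k $ i) (w $ (n - i)))"
    by (rule sum.swap)
  finally show ?thesis
    by (simp add: hact_nth scaleR_sum_right)
qed

lemma hact_hexp:
  assumes z: "z $ 0 = 0" and act: "\<And>w. hact z w = K * w * \<tau>"
  shows "hact (hexp z) w = exp_sandwich K \<tau> w"
proof -
  have "hact (z ^ k) w = K ^ k * w * \<tau> ^ k" for k
    by (induction k) (simp_all add: hact_mult act mult.assoc power_commutes)
  then show ?thesis
    by (simp add: fps_eq_iff hexp_def hact_hsubst_nth[OF z] exp_sandwich_def)
qed

end

lemma hext_mult_right:
  fixes c :: "'b::ring_1 fps"
  shows "hext (\<lambda>x. \<phi> x * c) v = hext \<phi> v * c"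
proof (rule fps_ext)
  fix n
  have "(hext \<phi> v * c) $ n = (\<Sum>j=0..n. \<Sum>i=0..j. \<phi> (v $ i) $ (j - i) * c $ (n - j))"
    by (simp add: hext_def fps_mult_nth atLeast0AtMost sum_distrib_right)
  also have "\<dots> = (\<Sum>j=0..n. \<Sum>i=0..n - j. \<phi> (v $ j) $ i * c $ (n - j - i))"
    by (rule fps_mult_assoc_lemma)
  also have "\<dots> = hext (\<lambda>x. \<phi> x * c) v $ n"
    by (simp add: hext_def fps_mult_nth atLeast0AtMost)
  finally show "hext (\<lambda>x. \<phi> x * c) v $ n = (hext \<phi> v * c) $ n" ..
qed

section \<open>The twisted adjoint action\<close>

lemma hinv_inverse:
  fixes y :: "'a::real_algebra_1 fps"
  assumes "y $ 0 = 1"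
  shows "hinv y * y = 1" and "y * hinv y = 1"
  using assms fps_left_inverse[of 1 y] fps_right_inverse'[of 1 y 1] by (simp_all add: hinv_def)

lemma sl2_term_eval:
  assumes "f Zero_gen * f Plus_gen - f Plus_gen * f Zero_gen = 2 * f Plus_gen"
    and "f Zero_gen * f Minus_gen - f Minus_gen * f Zero_gen = - 2 * f Minus_gen"
    and "f Plus_gen * f Minus_gen - f Minus_gen * f Plus_gen = f Zero_gen"
  shows "alg_rel s t \<Longrightarrow> term_eval f s = term_eval f t"
  using assms by (auto simp: alg_rel_sl2_gen_def)

text \<open>An antihomomorphism is a homomorphism to the opposite algebra, so each commutator in the
  hypotheses carries the opposite sign.\<close>

lemma sl2_term_anti_eval:
  assumes "f Zero_gen * f Plus_gen - f Plus_gen * f Zero_gen = - 2 * f Plus_gen"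
    and "f Zero_gen * f Minus_gen - f Minus_gen * f Zero_gen = 2 * f Minus_gen"
    and "f Plus_gen * f Minus_gen - f Minus_gen * f Plus_gen = - f Zero_gen"
  shows "alg_rel s t \<Longrightarrow> term_anti_eval f s = term_anti_eval f t"
proof -
  have "f Plus_gen * f Zero_gen - f Zero_gen * f Plus_gen = f Plus_gen * 2"
    "f Minus_gen * f Zero_gen - f Zero_gen * f Minus_gen = f Minus_gen * - 2"
    "f Minus_gen * f Plus_gen - f Plus_gen * f Minus_gen = f Zero_gen"
    using assms by (simp_all add: algebra_simps mult_2 mult_2_right)
  then show "alg_rel s t \<Longrightarrow> term_anti_eval f s = term_anti_eval f t"
    by (auto simp: alg_rel_sl2_gen_def)
qed

lemma usl2_commutators:
  "J0 * Jp - Jp * J0 = 2 * Jp" "J0 * Jm - Jm * J0 = - 2 * Jm" "Jp * Jm - Jm * Jp = J0"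
proof -
  have eval: "term_eval gen s = term_eval gen t" if "alg_rel s t" for s t :: "sl2_gen alg_term"
    using that by (simp add: term_eval_gen[of "\<lambda>g. g"] alg_term.map_ident alg_rel_presented)
  show "J0 * Jp - Jp * J0 = 2 * Jp"
    using eval[of "Comm (Gen Zero_gen) (Gen Plus_gen)" "Times (Scal 2) (Gen Plus_gen)"]
    by (simp add: alg_rel_sl2_gen_def)
  show "J0 * Jm - Jm * J0 = - 2 * Jm"
    using eval[of "Comm (Gen Zero_gen) (Gen Minus_gen)" "Times (Scal (-2)) (Gen Minus_gen)"]
    by (simp add: alg_rel_sl2_gen_def)
  show "Jp * Jm - Jm * Jp = J0"
    using eval[of "Comm (Gen Plus_gen) (Gen Minus_gen)" "Gen Zero_gen"]
    by (simp add: alg_rel_sl2_gen_def)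
qed

lemma coproduct_gen: "coproduct (gen g) = gen g \<otimes> 1 + 1 \<otimes> gen g"
proof -
  \<comment> \<open>The cross terms cancel because the two legs commute; hence the primitive
    elements satisfy the relations of sl(2).\<close>
  have commutator: "(x \<otimes> 1 + 1 \<otimes> x) * (y \<otimes> 1 + 1 \<otimes> y) - (y \<otimes> 1 + 1 \<otimes> y) * (x \<otimes> 1 + 1 \<otimes> x)
      = tensor_left (x * y - y * x) + tensor_right (x * y - y * x)" for x y
  proof -
    have diff: "tensor_left (u - v) = tensor_left u - tensor_left v"
      "tensor_right (u - v) = tensor_right u - tensor_right v" for u v
      using tensor_left.add[of u "- v"] tensor_right.add[of u "- v"]
      by (simp_all add: tensor_left.minus tensor_right.minus)
    show ?thesis
      unfolding tensor_def tensor_left.one tensor_right.one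
      by (simp add: diff tensor_left.mult tensor_right.mult tensor_left_right_commute algebra_simps)
  qed
  have scale: "tensor_left (of_real c * x) + tensor_right (of_real c * x)
      = of_real c * (x \<otimes> 1 + 1 \<otimes> x)" for c x
    by (simp add: tensor_def tensor_left.one tensor_right.one tensor_left.mult tensor_right.mult
        tensor_left.of_real tensor_right.of_real semiring_class.distrib_left)
  show ?thesis
    unfolding coproduct_def
    by (rule algebra_hom_alg_hom(2)[OF sl2_term_eval], unfold commutator usl2_commutators)
      (use scale[of 2] scale[of "- 2"] scale[of 1] in \<open>simp_all add: tensor_gen\<close>)
qed

interpretation antipode: algebra_antihom antipode
  unfolding antipode_def
  by (rule algebra_antihom_alg_antihom(1)[OF sl2_term_anti_eval])
    (use usl2_commutators in \<open>simp_all add: algebra_simps\<close>)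

lemma antipode_gen: "antipode (gen g) = - gen g"
  unfolding antipode_def
  by (rule algebra_antihom_alg_antihom(2)[OF sl2_term_anti_eval])
    (use usl2_commutators in \<open>simp_all add: algebra_simps\<close>)

text \<open>Kept general because two instances occur: the identity of \<open>usl2\<close>, where
  \<open>twist_u\<close> is computed, and the boson realization.\<close>

locale usl2_representation = algebra_hom R
  for R :: "usl2 \<Rightarrow> 'a::real_algebra_1"
begin

sublocale tensor_action R "\<lambda>y. R (antipode y)"
  by unfold_locales (simp_all add: antipode.add antipode.mult antipode.of_real add mult of_real)

definition Rh :: "usl2 fps \<Rightarrow> 'a fps"
  where "Rh = hext (\<lambda>z. fps_const (R z))"

lemma Rh_nth [simp]: "Rh v $ n = R (v $ n)"
  by (simp add: Rh_def hext_const zero)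

lemma R_sum: "R (sum f A) = (\<Sum>i\<in>A. R (f i))"
  by (induction A rule: infinite_finite_induct) (simp_all add: add zero)

lemma Rh_mult: "Rh (v * w) = Rh v * Rh w"
  by (simp add: fps_eq_iff fps_mult_nth R_sum mult)

lemma Rh_const: "Rh (fps_const z) = fps_const (R z)"
  by (simp add: fps_eq_iff zero)

lemma Rh_one: "Rh 1 = 1"
  by (simp add: fps_eq_iff zero one)

text \<open>Second leg of the exponent -(1/2) J0 \<otimes> sigma after the antipode, under which J+
  becomes -J+.\<close>

definition \<tau> :: "'a fps"
  where "\<tau> = hscale (- 1 / 2) (sigma (- R Jp))"

lemma \<tau>_nth_0 [simp]: "\<tau> $ 0 = 0"
  by (simp add: \<tau>_def sigma_eq_hcalc)

lemma hact_twist: "hact twist w = exp_sandwich (fps_const (R J0)) \<tau> w"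
  unfolding twist_def
proof (rule hact_hexp)
  let ?s = "hext (\<lambda>y. fps_const (J0 \<otimes> y)) (sigma Jp)"
  show "hscale (- 1 / 2) ?s $ 0 = 0"
    by (simp add: hext_def sigma_eq_hcalc tensor_def tensor_right.zero)
  have "Abs_fps (\<lambda>n. R (antipode (sigma Jp $ n))) = sigma (- R Jp)"
    by (simp add: fps_eq_iff sigma_eq_hcalc rho.scaleR rho.power antipode_gen minus)
  then show "hact (hscale (- 1 / 2) ?s) w = fps_const (R J0) * w * \<tau>" for w
    by (simp only: hact_hscale hact_hext_tensor \<tau>_def hscale_mult_right)
qed

end

interpretation usl2_self: usl2_representation "\<lambda>x. x"
  by unfold_locales simp_all

text \<open>m (id \<otimes> S) is the action on 1, so u is the twist applied to 1 inside
  \<open>usl2\<close>.\<close>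

lemma twist_u_eq: "twist_u = Abs_fps (\<lambda>n. usl2_self.act (twist $ n) 1)"
proof -
  have "sweedler (\<lambda>x y. fps_const (x * antipode y)) = (\<lambda>v. fps_const (usl2_self.act v 1))"
    by (rule ext, rule sweedler_eq) (simp_all add: usl2_self.act_tensor usl2_self.act_add)
  then show ?thesis
    unfolding twist_u_def by (simp add: hext_const)
qed

lemma twist_nth_0: "twist $ 0 = 1"
  by (simp add: twist_def hexp_def)

lemma twist_u_nth_0: "twist_u $ 0 = 1"
  by (simp add: twist_u_eq twist_nth_0)

context usl2_representation
begin

text \<open>Carries the computation of u from \<open>usl2\<close> over to the operators, where it
  becomes \<open>U_eq\<close>.\<close>

lemma R_act_self: "R (usl2_self.act v c) = act v (R c)"
proof (induction v arbitrary: c rule: presented_induct)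
  case (gen g)
  show ?case
    by (cases g) (simp_all add: mult)
next
  case (of_real k)
  show ?case
    by (simp add: usl2_self.act_of_real act_of_real scaleR)
qed (simp_all add: usl2_self.act_add act_add usl2_self.act_mult act_mult add)

abbreviation U :: "'a fps" where "U \<equiv> Rh twist_u"
abbreviation U' :: "'a fps" where "U' \<equiv> Rh (hinv twist_u)"

lemma U_inverse: "U * U' = 1" "U' * U = 1"
  by (simp_all add: hinv_inverse[OF twist_u_nth_0] Rh_one flip: Rh_mult)

lemma U_eq: "U = exp_sandwich (fps_const (R J0)) \<tau> 1"
proof -
  have "hact twist 1 $ n = act (twist $ n) 1" for n
  proof -
    have "hact twist 1 $ n = (\<Sum>i=0..n. if i = n then act (twist $ n) 1 else 0)"
      unfolding hact_nth by (intro sum.cong) (auto simp: fps_one_nth)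
    then show ?thesis by simp
  qed
  then show ?thesis
    by (simp add: fps_eq_iff twist_u_eq R_act_self one flip: hact_twist)
qed

definition twisted_ad :: "usl2 \<Rightarrow> 'a fps \<Rightarrow> 'a fps"
  where "twisted_ad X t = hext (sweedler (\<lambda>x y. fps_const (R x) * t
      * hext (\<lambda>z. fps_const (R z)) (twisted_antipode y))) (twisted_coproduct X)"

text \<open>The conjugation in the twisted antipode puts \<open>U\<close> behind \<open>t\<close>
  and \<open>U'\<close> at the far right; between them the untwisted antipode remains, hence the
  action of the locale.\<close>

lemma twisted_ad_eq: "twisted_ad X t = hact (twisted_coproduct X) (t * U) * U'"
proof -
  have "sweedler (\<lambda>x y. fps_const (R x) * t * Rh (twisted_antipode y)) v
      = hact (fps_const v) (t * U) * U'" for v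
  proof (rule sweedler_eq)
    show "fps_const (R x) * t * Rh (twisted_antipode y) = hact (fps_const (x \<otimes> y)) (t * U) * U'" for x y
      by (simp add: twisted_antipode_def Rh_mult Rh_const hact_const_tensor mult.assoc)
    have hact_add: "hact (fps_const (v + w)) t = hact (fps_const v) t + hact (fps_const w) t" for v w t
      by (simp add: hact_const act_add fps_eq_iff)
    show "hact (fps_const (v + w)) (t * U) * U'
        = hact (fps_const v) (t * U) * U' + hact (fps_const w) (t * U) * U'" for v w
      by (simp only: hact_add semiring_class.distrib_right)
    have "hact (fps_const 0) (t * U) = 0"
      by (simp add: hact_const fps_eq_iff del: fps_const_0_eq_0)
    then show "hact (fps_const 0) (t * U) * U' = 0"
      by (simp only: mult_zero_left)
  qed
  then have "sweedler (\<lambda>x y. fps_const (R x) * t * Rh (twisted_antipode y))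
      = (\<lambda>v. Abs_fps (\<lambda>n. act v ((t * U) $ n)) * U')"
    by (auto simp only: hact_const)
  then show ?thesis
    unfolding twisted_ad_def Rh_def[symmetric] by (simp add: hext_mult_right hact_def)
qed

lemma twisted_ad_gen:
  "twisted_ad (gen g) (hact twist w * U') = hact twist (fps_const (R (gen g)) * w - w * fps_const (R (gen g))) * U'"
proof -
  \<comment> \<open>Once \<open>U' * U\<close> cancels, the inverse twist in the coproduct meets the
    twist.\<close>
  have "hact twist w * U' * U = hact twist w"
    by (simp add: mult.assoc U_inverse)
  moreover have "hact (fps_const (coproduct (gen g))) w = fps_const (R (gen g)) * w - w * fps_const (R (gen g))"
    by (simp add: fps_eq_iff hact_const coproduct_gen act_add act_tensor one antipode_gen minus antipode.one)
  ultimately show ?thesis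
    by (simp add: twisted_ad_eq twisted_coproduct_def hact_mult[symmetric] mult.assoc hinv_inverse[OF twist_nth_0])
      (simp add: hact_mult)
qed

lemma hact_twist_weight:
  assumes "R J0 * p - p * R J0 = c *\<^sub>R p"
  shows "hact twist (fps_const p) = fps_const p * U * hcalc (- R Jp) (exp_sigma (- c / 2))"
proof -
  have "R J0 * p = p * (R J0 + of_real c)"
    using assms by (simp add: algebra_simps of_real_def diff_eq_eq)
  then have "fps_const (R J0) * fps_const p = fps_const p * (fps_const (R J0) + fps_const (of_real c))"
    by simp
  \<comment> \<open>Written as \<open>p\<close> times 1, so that after \<open>p\<close> has moved
    out the exponential acts on 1, as in \<open>U_eq\<close>.\<close>
  then have "hact twist (fps_const p * 1)
      = fps_const p * exp_sandwich (fps_const (R J0) + fps_const (of_real c)) \<tau> 1"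
    unfolding hact_twist by (intro exp_sandwich_mult_left) simp_all
  also have "\<dots> = fps_const p * (U * hexp (hscale c \<tau>))"
    by (simp only: exp_sandwich_add_scalar[OF \<tau>_nth_0] U_eq)
  also have "hscale c \<tau> = hscale (- c / 2) (sigma (- R Jp))"
  proof -
    have "hscale c (hscale b w) = hscale (c * b) w" for b and w :: "'a fps"
      by (simp flip: mult.assoc)
    moreover have "c * (- 1 / 2) = - c / 2"
      by simp
    ultimately show ?thesis
      by (simp only: \<tau>_def)
  qed
  finally show ?thesis
    by (simp only: hexp_sigma mult.assoc mult_1_right)
qed

text \<open>
  The twist maps \<open>J\<^sub>+\<close> to \<open>U J\<^sub>+\<close>, since \<open>J\<^sub>+\<close> commutes with \<open>\<tau>\<close>, and to \<open>J\<^sub>+ U (1 + 2 h J\<^sub>+)\<close>, since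
  \<open>J\<^sub>+\<close> has weight 2.  Hence conjugation by \<open>U\<close> sends \<open>- h J\<^sub>+\<close> to \<open>y(h J\<^sub>+)\<close> with \<open>y = - h / (1 - 2 h)\<close>.
\<close>

lemma U_conjugate:
  assumes y: "(1 - 2 * fps_X) * y = - fps_X"
  shows "U * hcalc (- R Jp) f * U' = hcalc (R Jp) (f oo y)"
proof -
  let ?J = "fps_const (R Jp)" and ?W = "hcalc (- R Jp) fps_X"
  define Y where "Y = U * ?W * U'"
  have J_comm: "R J0 * R Jp - R Jp * R J0 = 2 *\<^sub>R R Jp"
  proof -
    have "R (J0 * Jp - Jp * J0) = R (2 *\<^sub>R Jp)"
      by (simp only: usl2_commutators scaleR_2 mult_2)
    then show ?thesis
      using add[of "J0 * Jp" "- (Jp * J0)"] by (simp add: minus mult scaleR)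
  qed
  have "U * ?J = hact twist (1 * ?J)"
  proof -
    have "?J * hcalc (- R Jp) f = hcalc (- R Jp) f * ?J" for f
      unfolding hcalc_uminus by (simp add: fps_eq_iff power_commutes)
    then have "?J * \<tau> = \<tau> * ?J"
      by (simp only: \<tau>_def sigma_eq_hcalc hscale_mult_left hscale_mult_right)
    then show ?thesis
      by (simp only: hact_twist exp_sandwich_mult_right[OF \<tau>_nth_0] U_eq)
  qed
  also have "\<dots> = ?J * U * (1 - 2 * ?W)"
    using hact_twist_weight[OF J_comm]
  proof -
    \<comment> \<open>Weight 2 gives \<open>exp_sigma (- 1)\<close>, the polynomial 1 - 2 X,
      evaluated here at -h J+.\<close>
    have "hcalc (- R Jp) (1 - 2 * fps_X) = 1 - 2 * ?W"
      by (simp only: mult_2 hcalc_diff hcalc_one hcalc_add)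
    moreover have "- 2 / 2 = (- 1 :: real)"
      by simp
    ultimately show ?thesis
      using hact_twist_weight[OF J_comm] by (simp only: exp_sigma_minus_one mult_1_left)
  qed
  finally have UJ: "U * ?J = ?J * U * (1 - 2 * ?W)" .
  have W: "?W = - (fps_X * ?J)"
    by (simp add: hcalc_X flip: fps_const_neg)
  \<comment> \<open>Replacing U J+ by means of \<open>UJ\<close> brings \<open>Y\<close> back on the
    right, so \<open>Y\<close> solves a linear equation with coefficients in h J+.\<close>
  have "Y = - (fps_X * (U * ?J * U'))"
    unfolding Y_def W by (simp add: mult.assoc) (metis fps_mult_fps_X_commute mult.assoc)
  also have "\<dots> = ?W * (U * U' - 2 * Y)"
    unfolding UJ Y_def W by (simp add: algebra_simps mult_2)
  finally have "Y + 2 * (?W * Y) = ?W"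
    by (simp add: U_inverse algebra_simps mult_2)
  moreover have "hcalc (R Jp) (1 - 2 * fps_X) = 1 + 2 * ?W" and "hcalc (R Jp) (- fps_X) = ?W"
    by (auto simp: fps_eq_iff fps_X_def numeral_fps_const scaleR_conv_of_real)
  ultimately have WY: "hcalc (R Jp) (1 - 2 * fps_X) * Y = hcalc (R Jp) (- fps_X)"
    by (simp add: semiring_class.distrib_right mult.assoc)
  \<comment> \<open>The inverse of 1 - 2 X is taken over \<open>real\<close> and applied from the
    left, which presupposes no commutation with \<open>Y\<close>.\<close>
  have "hcalc (R Jp) (inverse (1 - 2 * fps_X)) * hcalc (R Jp) (1 - 2 * fps_X) = 1"
    by (simp add: inverse_mult_eq_1 flip: hcalc_mult)
  then have "Y = hcalc (R Jp) (inverse (1 - 2 * fps_X)) * hcalc (R Jp) (1 - 2 * fps_X) * Y"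
    by (simp only: mult_1_left)
  also have "\<dots> = hcalc (R Jp) (inverse (1 - 2 * fps_X) * - fps_X)"
    by (simp only: mult.assoc WY hcalc_mult)
  also have "inverse (1 - 2 * fps_X) * - fps_X = y"
    by (simp add: inverse_mult_eq_1 mult.assoc[symmetric] flip: y)
  finally have Y: "Y = hcalc (R Jp) y" .
  have "U * hcalc (- R Jp) f * U' = U * hsubst f ?W * U'"
    by (simp add: hsubst_hcalc)
  also have "\<dots> = hsubst f Y"
    unfolding Y_def by (rule hsubst_conjugate) (simp_all add: U_inverse)
  finally show ?thesis
    by (simp add: Y hsubst_hcalc)
qed

text \<open>The \<open>U\<close> left over in \<open>hact_twist_weight\<close> is absorbed by
  conjugation, which flips the sign of the exponent and trades -J+ for J+.\<close>

lemma hact_twist_weight_U: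
  assumes "R J0 * p - p * R J0 = c *\<^sub>R p"
  shows "hact twist (fps_const p) * U' = fps_const p * hexp (hscale (c / 2) (sigma (R Jp)))"
proof -
  define y :: "real fps" where "y = - fps_X * inverse (1 - 2 * fps_X)"
  have y: "(1 - 2 * fps_X) * y = - fps_X"
    by (simp add: y_def mult.left_commute inverse_mult_eq_1')
  show ?thesis
    unfolding hact_twist_weight[OF assms]
    using U_conjugate[OF y, of "exp_sigma (- c / 2)"] exp_sigma_compose[OF y, of "- c / 2"]
    by (simp add: mult.assoc hexp_sigma)
qed

text \<open>The exponent is half the weight on either side, so a commutator relation between weight
  vectors passes to the twisted action with the same coefficient, whichever generator it
  involves.\<close>

lemma twisted_ad_weight:
  assumes "R J0 * p - p * R J0 = (2 * m) *\<^sub>R p" and "R J0 * q - q * R J0 = (2 * m') *\<^sub>R q"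
    and "R (gen g) * p - p * R (gen g) = c *\<^sub>R q"
  shows "twisted_ad (gen g) (fps_const p * hexp (hscale m (sigma (R Jp))))
    = hscale c (fps_const q * hexp (hscale m' (sigma (R Jp))))"
proof -
  have p: "fps_const p * hexp (hscale m (sigma (R Jp))) = hact twist (fps_const p) * U'"
    using hact_twist_weight_U[OF assms(1)] by simp
  have q: "fps_const q * hexp (hscale m' (sigma (R Jp))) = hact twist (fps_const q) * U'"
    using hact_twist_weight_U[OF assms(2)] by simp
  have "fps_const (R (gen g)) * fps_const p - fps_const p * fps_const (R (gen g)) = hscale c (fps_const q)"
    using assms(3) by (simp add: of_real_def)
  moreover have "hact twist (hscale c w) = hscale c (hact twist w)" for w
    by (simp add: fps_eq_iff hact_nth of_real_def act_scaleR_right scaleR_sum_right)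
  ultimately show ?thesis
    unfolding p q twisted_ad_gen by (simp only: hscale_mult_left)
qed

end

section \<open>The symplecton\<close>

definition sym_mult :: "'a::ring \<Rightarrow> 'a \<Rightarrow> 'a"
  where "sym_mult b x = b * x + x * b"

lemma sym_mult_scaleR: "sym_mult b (c *\<^sub>R x) = c *\<^sub>R sym_mult b x"
  for x :: "'a::real_algebra_1"
  by (simp add: sym_mult_def algebra_simps)

lemma sym_mult_power_scaleR: "(sym_mult b ^^ p) (c *\<^sub>R x) = c *\<^sub>R (sym_mult b ^^ p) x"
  for x :: "'a::real_algebra_1"
  by (induction p) (simp_all add: sym_mult_scaleR)

text \<open>
  As left and right multiplication commute, the sum defining the symplecton is a binomial expansion.
\<close>

lemma sym_mult_power_eq:
  fixes b x :: "'a::real_algebra_1"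
  shows "(1 / fact p) *\<^sub>R (sym_mult b ^^ p) x
    = (\<Sum>s\<le>p. (1 / (fact s * fact (p - s))) *\<^sub>R (b ^ (p - s) * x * b ^ s))"
proof (induction p)
  case (Suc p)
  let ?g = "\<lambda>p s. (1 / (fact s * fact (p - s))) *\<^sub>R (b ^ (p - s) * x * b ^ s)"
  \<comment> \<open>Left and right multiplication give index s the weights p + 1 - s and s, whose
    sum is the same for all s; the end terms added to the two ranges have weight 0.\<close>
  have left: "b * ?g p s = real (Suc p - s) *\<^sub>R ?g (Suc p) s" if "s \<le> p" for s
    using that by (simp add: Suc_diff_le mult.assoc del: of_nat_Suc)
  have right: "?g p s * b = real (Suc s) *\<^sub>R ?g (Suc p) (Suc s)" for s
    by (simp add: mult.assoc power_commutes)
  have "real (Suc p) *\<^sub>R ((1 / fact (Suc p)) *\<^sub>R (sym_mult b ^^ Suc p) x)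
      = sym_mult b ((1 / fact p) *\<^sub>R (sym_mult b ^^ p) x)"
    by (simp add: sym_mult_scaleR del: of_nat_Suc)
  also have "\<dots> = (\<Sum>s\<le>p. b * ?g p s) + (\<Sum>s\<le>p. ?g p s * b)"
    unfolding Suc sym_mult_def sum_distrib_left sum_distrib_right ..
  also have "(\<Sum>s\<le>p. b * ?g p s) = (\<Sum>s\<le>Suc p. real (Suc p - s) *\<^sub>R ?g (Suc p) s)"
    using left by simp
  also have "(\<Sum>s\<le>p. ?g p s * b) = (\<Sum>s\<le>Suc p. real s *\<^sub>R ?g (Suc p) s)"
    unfolding right by (subst sum.atMost_Suc_shift) simp
  also have "(\<Sum>s\<le>Suc p. real (Suc p - s) *\<^sub>R ?g (Suc p) s) + (\<Sum>s\<le>Suc p. real s *\<^sub>R ?g (Suc p) s)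
      = real (Suc p) *\<^sub>R (\<Sum>s\<le>Suc p. ?g (Suc p) s)"
    unfolding sum.distrib[symmetric] scaleR_sum_right
    by (intro sum.cong) (simp_all add: scaleR_left_distrib[symmetric] of_nat_diff diff_divide_distrib del: of_nat_Suc fact_Suc)
  finally show ?case
    by (rule scaleR_left_imp_eq[rotated]) simp
qed simp

section \<open>Commutators in the Weyl algebra\<close>

context
  fixes a abar :: "'a::real_algebra_1"
  assumes boson: "abar * a - a * abar = 1"
begin

lemma abar_a: "abar * a = a * abar + 1"
  using boson by (simp add: diff_eq_eq add.commute)

lemma abar_a_left: "abar * (a * x) = a * (abar * x) + x"
  using arg_cong[OF abar_a, of "\<lambda>y. y * x"] by (simp add: algebra_simps)

text \<open>\<open>abar\<close> differentiates powers of \<open>a\<close>; for q = 0 the factor 0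
  masks the truncated exponent.\<close>

lemma abar_power: "abar * a ^ q - a ^ q * abar = real q *\<^sub>R a ^ (q - 1)"
proof (induction q)
  case (Suc q)
  have "abar * a ^ Suc q - a ^ Suc q * abar = a * (abar * a ^ q - a ^ q * abar) + a ^ q"
    by (simp add: abar_a_left algebra_simps)
  also have "\<dots> = real (Suc q) *\<^sub>R a ^ q"
    unfolding Suc by (cases q) (simp_all add: algebra_simps scaleR_2)
  finally show ?case by simp
qed simp

text \<open>The difference of the two sides is the double commutator [[a, abar], x], and [a, abar]
  is a scalar.\<close>

lemma sym_mult_commute: "sym_mult a (sym_mult abar x) = sym_mult abar (sym_mult a x)"
proof -
  have "x * (abar * a) = x * (a * abar) + x"
    by (simp add: abar_a algebra_simps)
  then show ?thesis
    by (simp add: sym_mult_def abar_a_left algebra_simps)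
qed

lemma sym_mult_power_commute: "sym_mult a ((sym_mult abar ^^ p) x) = (sym_mult abar ^^ p) (sym_mult a x)"
  by (induction p) (simp_all add: sym_mult_commute)

text \<open>Commuting with \<open>a\<close> is a derivation and [a, abar] = -1, so each
  \<open>sym_mult abar\<close> contributes an anticommutator with -1, that is, the factor
  -2.\<close>

lemma commutator_a_power:
  assumes "a * x = x * a"
  shows "a * (sym_mult abar ^^ p) x - (sym_mult abar ^^ p) x * a
    = (- 2 * real p) *\<^sub>R (sym_mult abar ^^ (p - 1)) x"
proof (induction p)
  case (Suc p)
  let ?y = "(sym_mult abar ^^ p) x"
  have "?y * (abar * a) = ?y * (a * abar) + ?y"
    by (simp add: abar_a algebra_simps)
  then have "a * sym_mult abar ?y - sym_mult abar ?y * a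
      = sym_mult abar (a * ?y - ?y * a) - 2 *\<^sub>R ?y"
    by (simp add: sym_mult_def abar_a_left algebra_simps scaleR_2)
  also have "\<dots> = (- 2 * real (Suc p)) *\<^sub>R ?y"
    unfolding Suc sym_mult_scaleR by (cases p) (simp_all flip: scaleR_left_distrib scaleR_left_diff_distrib)
  finally show ?case by simp
qed (simp add: assms)

text \<open>Equal to 2^p times the Weyl-ordered monomial in q factors \<open>a\<close> and p factors
  \<open>abar\<close>.\<close>

definition weyl :: "nat \<Rightarrow> nat \<Rightarrow> 'a"
  where "weyl p q = (sym_mult abar ^^ p) (a ^ q)"

text \<open>A commutator with a square is the anticommutator with a commutator: [a^2, w] = {a,
  [a, w]}. The anticommutator with \<open>a\<close> passes through those with \<open>abar\<close>
  down to \<open>a ^ q\<close>.\<close>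

lemma commutator_Jp_weyl:
  "boson_Jp a * weyl p q - weyl p q * boson_Jp a = (2 * real p) *\<^sub>R weyl (p - 1) (q + 1)"
proof -
  have "boson_Jp a * w - w * boson_Jp a = (- (1/2)) *\<^sub>R sym_mult a (a * w - w * a)" for w
    by (simp add: boson_Jp_def sym_mult_def power2_eq_square algebra_simps)
  then have "boson_Jp a * weyl p q - weyl p q * boson_Jp a
      = real p *\<^sub>R (sym_mult abar ^^ (p - 1)) (sym_mult a (a ^ q))"
    by (simp only: weyl_def commutator_a_power[OF power_commutes[symmetric]] sym_mult_scaleR
        sym_mult_power_commute) simp
  also have "sym_mult a (a ^ q) = 2 *\<^sub>R a ^ (q + 1)"
    by (simp add: sym_mult_def power_commutes scaleR_2)
  finally show ?thesis
    by (simp add: weyl_def sym_mult_power_scaleR mult.commute)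
qed

lemma commutator_Jm_weyl:
  "boson_Jm abar * weyl p q - weyl p q * boson_Jm abar = (real q / 2) *\<^sub>R weyl (p + 1) (q - 1)"
proof -
  have Jm: "boson_Jm abar * w - w * boson_Jm abar = (1/2) *\<^sub>R sym_mult abar (abar * w - w * abar)" for w
    by (simp add: boson_Jm_def sym_mult_def power2_eq_square algebra_simps)
  have "abar * weyl p q - weyl p q * abar = (sym_mult abar ^^ p) (abar * a ^ q - a ^ q * abar)"
  proof -
    have "abar * sym_mult abar y - sym_mult abar y * abar = sym_mult abar (abar * y - y * abar)" for y
      by (simp add: sym_mult_def algebra_simps)
    then show ?thesis
      unfolding weyl_def by (induction p) simp_all
  qed
  then show ?thesis
    unfolding Jm abar_power by (simp add: weyl_def sym_mult_power_scaleR sym_mult_scaleR)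
qed

text \<open>J0 is \<open>a * abar\<close> plus 1/2, so \<open>a\<close> has weight 1 and
  \<open>abar\<close> weight -1, and each \<open>sym_mult abar\<close> lowers the weight by
  1.\<close>

lemma commutator_J0_weyl:
  "boson_J0 a abar * weyl p q - weyl p q * boson_J0 a abar = (real q - real p) *\<^sub>R weyl p q"
proof -
  let ?J = "boson_J0 a abar"
  have J: "?J = a * abar + (1/2) *\<^sub>R 1"
    by (simp add: boson_J0_def abar_a algebra_simps flip: scaleR_left_distrib)
  have a: "?J * a = a * ?J + a"
    by (simp add: J abar_a algebra_simps)
  have abar: "?J * abar = abar * ?J - abar"
    by (simp add: J abar_a_left algebra_simps)
  have pow: "?J * a ^ q = a ^ q * ?J + real q *\<^sub>R a ^ q"
  proof (induction q)
    case (Suc q)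
    have "?J * a ^ Suc q = (?J * a) * a ^ q" by (simp add: mult.assoc)
    also have "\<dots> = a * (?J * a ^ q) + a ^ Suc q" by (simp add: a algebra_simps)
    also have "\<dots> = a ^ Suc q * ?J + real (Suc q) *\<^sub>R a ^ Suc q"
      by (simp add: Suc algebra_simps)
    finally show ?case .
  qed simp
  have "?J * (sym_mult abar ^^ p) (a ^ q)
      = (sym_mult abar ^^ p) (a ^ q) * ?J + (real q - real p) *\<^sub>R (sym_mult abar ^^ p) (a ^ q)"
  proof (induction p)
    case (Suc p)
    have abar_left: "?J * (abar * y) = abar * (?J * y) - abar * y" for y
      using arg_cong[OF abar, of "\<lambda>x. x * y"] by (simp add: algebra_simps)
    have "?J * sym_mult abar y = sym_mult abar y * ?J + (k - 1) *\<^sub>R sym_mult abar y"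
      if y: "?J * y = y * ?J + k *\<^sub>R y" for y k
    proof -
      have "?J * (y * abar) = (?J * y) * abar" by (simp add: mult.assoc)
      also have "\<dots> = y * (?J * abar) + k *\<^sub>R (y * abar)"
        unfolding y by (simp add: algebra_simps)
      finally have right: "?J * (y * abar) = y * abar * ?J + (k - 1) *\<^sub>R (y * abar)"
        by (simp add: abar algebra_simps)
      have left: "?J * (abar * y) = abar * y * ?J + (k - 1) *\<^sub>R (abar * y)"
        by (simp add: abar_left y algebra_simps)
      show ?thesis
        unfolding sym_mult_def semiring_class.distrib_left[of ?J] left right
        by (simp add: algebra_simps)
    qed
    from this[OF Suc] show ?case
      by (simp add: algebra_simps)
  qed (simp add: pow)
  then show ?thesis
    by (simp add: weyl_def)
qed

text \<open>\<open>p\<close> and \<open>q\<close> stand for j - m and j + m; the factorial in the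
  denominator comes from \<open>sym_mult_power_eq\<close>.\<close>

definition sympl_coeff :: "nat \<Rightarrow> nat \<Rightarrow> real"
  where "sympl_coeff p q = sqrt (fact (p + q) * fact p / fact q) / (2 ^ p * fact p)"

lemma symplecton_eq:
  assumes "j - m = real p" and "j + m = real q"
  shows "symplecton a abar j m = sympl_coeff p q *\<^sub>R weyl p q"
proof -
  have "2 * j = real (p + q)"
    using assms by simp
  then have "nat \<lfloor>2 * j\<rfloor> = p + q" "nat \<lfloor>j - m\<rfloor> = p" "nat \<lfloor>j + m\<rfloor> = q"
    unfolding assms by (simp_all del: of_nat_add)
  then show ?thesis
    by (simp add: symplecton_def sym_mult_power_eq[symmetric] weyl_def sympl_coeff_def)
qed

lemma sympl_coeff_step:
  "sympl_coeff (Suc p) q * (2 * real (Suc p)) = sqrt (real (Suc p) * real (Suc q)) * sympl_coeff p (Suc q)"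
  "sympl_coeff p (Suc q) * (real (Suc q) / 2) = sqrt (real (Suc p) * real (Suc q)) * sympl_coeff (Suc p) q"
proof -
  \<comment> \<open>Both neighbouring coefficients belong to 2 j = p + q + 1; their roots are this
    one times \<open>sqrt (real (Suc p))\<close> and this one divided by
    \<open>sqrt (real (Suc q))\<close>.\<close>
  let ?r = "sqrt (fact (p + Suc q) * fact p / fact q)"
  have root: "sqrt (fact (Suc p + q) * fact (Suc p) / fact q) = sqrt (real (Suc p)) * ?r"
    "sqrt (fact (p + Suc q) * fact p / fact (Suc q)) = ?r / sqrt (real (Suc q))"
  proof -
    have "fact (Suc p + q) * fact (Suc p) / fact q
        = real (Suc p) * (fact (p + Suc q) * fact p / fact q)"
      unfolding fact_Suc[of p] by simp
    then show "sqrt (fact (Suc p + q) * fact (Suc p) / fact q) = sqrt (real (Suc p)) * ?r"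
      by (simp only: real_sqrt_mult)
    have "fact (p + Suc q) * fact p / fact (Suc q) = fact (p + Suc q) * fact p / fact q / real (Suc q)"
      unfolding fact_Suc[of q] by (simp del: of_nat_Suc)
    then show "sqrt (fact (p + Suc q) * fact p / fact (Suc q)) = ?r / sqrt (real (Suc q))"
      by (simp only: real_sqrt_divide)
  qed
  have sq: "sqrt (real (Suc k)) * sqrt (real (Suc k)) = real (Suc k)" for k
    by simp
  have pos: "sqrt (real (Suc k)) \<noteq> 0" for k
    by simp
  show "sympl_coeff (Suc p) q * (2 * real (Suc p)) = sqrt (real (Suc p) * real (Suc q)) * sympl_coeff p (Suc q)"
    unfolding sympl_coeff_def root unfolding real_sqrt_mult[of "real (Suc p)"] fact_Suc[of p]
    using pos[of q] by (simp add: field_simps del: of_nat_Suc)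
  have "sympl_coeff p (Suc q) * (real (Suc q) / 2)
      = ?r * (real (Suc q) / sqrt (real (Suc q))) / (2 ^ Suc p * fact p)"
    unfolding sympl_coeff_def root by (simp del: of_nat_Suc)
  also have "real (Suc q) / sqrt (real (Suc q)) = sqrt (real (Suc q))"
    by (rule real_div_sqrt) simp
  also have "?r * sqrt (real (Suc q)) / (2 ^ Suc p * fact p)
      = sqrt (real (Suc q)) * real (Suc p) * ?r / (2 ^ Suc p * fact (Suc p))"
  proof -
    have "x * y / (z * fact p) = y * real (Suc p) * x / (z * fact (Suc p))" for x y z :: real
      unfolding fact_Suc[of p] by (simp add: mult_ac del: of_nat_Suc)
    then show ?thesis .
  qed
  also have "\<dots> = sqrt (real (Suc q)) * (sqrt (real (Suc p)) * sqrt (real (Suc p))) * ?r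
      / (2 ^ Suc p * fact (Suc p))"
    by (simp only: sq)
  also have "\<dots> = sqrt (real (Suc p) * real (Suc q)) * sympl_coeff (Suc p) q"
    unfolding sympl_coeff_def root real_sqrt_mult[of "real (Suc p)"]
    by (simp only: mult_ac times_divide_eq_right times_divide_eq_left)
  finally show "sympl_coeff p (Suc q) * (real (Suc q) / 2)
      = sqrt (real (Suc p) * real (Suc q)) * sympl_coeff (Suc p) q" .
qed


text \<open>With the generators as multiples of \<open>weyl\<close>, the relations of sl(2) become
  instances of commutators already computed.\<close>

lemma boson_Jp_eq: "boson_Jp a = (- 1 / 2) *\<^sub>R weyl 0 2"
  by (simp add: boson_Jp_def weyl_def)

text \<open>\<open>sym_mult abar\<close> doubles powers of \<open>abar\<close>, so
  \<open>weyl 2 0\<close> is four times the square and 1/2 becomes 1/8.\<close>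

lemma boson_Jm_eq: "boson_Jm abar = (1 / 8) *\<^sub>R weyl 2 0"
  by (simp add: boson_Jm_def weyl_def sym_mult_def numeral_2_eq_2 algebra_simps flip: scaleR_left_distrib)

lemma boson_J0_eq: "boson_J0 a abar = (1 / 2) *\<^sub>R weyl 1 1"
  by (simp add: boson_J0_def weyl_def sym_mult_def add.commute)

lemma commutator_scaleR: "x * (c *\<^sub>R y) - (c *\<^sub>R y) * x = c *\<^sub>R (x * y - y * x)"
  for x y :: 'a
  by (simp add: scaleR_right_diff_distrib)

lemma boson_sl2:
  defines "f \<equiv> \<lambda>g. case g of Plus_gen \<Rightarrow> boson_Jp a | Minus_gen \<Rightarrow> boson_Jm abar
      | Zero_gen \<Rightarrow> boson_J0 a abar"
  shows "alg_rel s t \<Longrightarrow> term_eval f s = term_eval f t"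
proof (rule sl2_term_eval)
  show "f Zero_gen * f Plus_gen - f Plus_gen * f Zero_gen = 2 * f Plus_gen"
    unfolding f_def sl2_gen.case boson_Jp_eq commutator_scaleR commutator_J0_weyl
    by (simp add: mult_2 flip: scaleR_left_distrib)
  have "- 2 * x = (- 2) *\<^sub>R x" for x :: 'a
    by (simp add: scaleR_conv_of_real)
  then show "f Zero_gen * f Minus_gen - f Minus_gen * f Zero_gen = - 2 * f Minus_gen"
    unfolding f_def sl2_gen.case boson_Jm_eq commutator_scaleR commutator_J0_weyl
    by simp
  show "f Plus_gen * f Minus_gen - f Minus_gen * f Plus_gen = f Zero_gen"
    unfolding f_def sl2_gen.case boson_Jm_eq boson_J0_eq commutator_scaleR commutator_Jp_weyl
    by simp
qed

lemma algebra_hom_realization: "algebra_hom (realization a abar)"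
  unfolding realization_def by (rule algebra_hom_alg_hom(1)[OF boson_sl2])

lemma realization_gen:
  "realization a abar Jp = boson_Jp a" "realization a abar Jm = boson_Jm abar"
  "realization a abar J0 = boson_J0 a abar"
  unfolding realization_def by (simp_all add: algebra_hom_alg_hom(2)[OF boson_sl2])

text \<open>At m = j the parameter m + 1 leaves the range, and there \<open>symplecton\<close> is a
  multiple of a^(2 j + 1), whose weight is 2 j + 1 instead of 2 (m + 1). The conditional puts 0 in
  its place, consistently with the vanishing square root. The same happens below m = -j.\<close>

lemma commutator_symplecton:
  assumes "j - m = real p" and "j + m = real q"
  shows "boson_J0 a abar * symplecton a abar j m - symplecton a abar j m * boson_J0 a abar
      = (2 * m) *\<^sub>R symplecton a abar j m"
    and "boson_Jp a * symplecton a abar j m - symplecton a abar j m * boson_Jp a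
      = sqrt ((j - m) * (j + m + 1)) *\<^sub>R (if p = 0 then 0 else symplecton a abar j (m + 1))"
    and "boson_Jm abar * symplecton a abar j m - symplecton a abar j m * boson_Jm abar
      = sqrt ((j + m) * (j - m + 1)) *\<^sub>R (if q = 0 then 0 else symplecton a abar j (m - 1))"
proof -
  have P: "symplecton a abar j m = sympl_coeff p q *\<^sub>R weyl p q"
    by (rule symplecton_eq[OF assms])
  have "2 * m = real q - real p"
    using assms by simp
  then show "boson_J0 a abar * symplecton a abar j m - symplecton a abar j m * boson_J0 a abar
      = (2 * m) *\<^sub>R symplecton a abar j m"
    unfolding P commutator_scaleR commutator_J0_weyl by (simp add: mult.commute)
  show "boson_Jp a * symplecton a abar j m - symplecton a abar j m * boson_Jp a
      = sqrt ((j - m) * (j + m + 1)) *\<^sub>R (if p = 0 then 0 else symplecton a abar j (m + 1))"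
  proof (cases p)
    case 0
    then show ?thesis unfolding P commutator_scaleR commutator_Jp_weyl by simp
  next
    case (Suc p')
    have "symplecton a abar j (m + 1) = sympl_coeff p' (Suc q) *\<^sub>R weyl p' (Suc q)"
      using assms Suc by (intro symplecton_eq) simp_all
    moreover have "(j - m) * (j + m + 1) = real (Suc p') * real (Suc q)"
      using assms Suc by simp
    ultimately show ?thesis
      unfolding P commutator_scaleR commutator_Jp_weyl using sympl_coeff_step(1)[of p' q] Suc
      by (simp del: of_nat_Suc)
  qed
  show "boson_Jm abar * symplecton a abar j m - symplecton a abar j m * boson_Jm abar
      = sqrt ((j + m) * (j - m + 1)) *\<^sub>R (if q = 0 then 0 else symplecton a abar j (m - 1))"
  proof (cases q)
    case 0
    then show ?thesis unfolding P commutator_scaleR commutator_Jm_weyl by simp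
  next
    case (Suc q')
    have "symplecton a abar j (m - 1) = sympl_coeff (Suc p) q' *\<^sub>R weyl (Suc p) q'"
      using assms Suc by (intro symplecton_eq) simp_all
    moreover have "(j + m) * (j - m + 1) = real (Suc p) * real (Suc q')"
      using assms Suc by (simp add: mult.commute)
    ultimately show ?thesis
      unfolding P commutator_scaleR commutator_Jm_weyl using sympl_coeff_step(2)[of p q'] Suc
      by (simp del: of_nat_Suc)
  qed
qed

section \<open>Transfer to the h-symplecton\<close>

interpretation realization: usl2_representation "realization a abar"
  unfolding usl2_representation_def by (rule algebra_hom_realization)

lemma ad_eq_twisted_ad: "ad a abar = realization.twisted_ad"
  by (intro ext) (simp add: ad_def realization.twisted_ad_def)

lemma ad_h_symplecton:
  assumes pq: "j - m = real p" "j + m = real q"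
  shows "ad a abar Jp (h_symplecton a abar j m)
        = hscale (sqrt ((j - m) * (j + m + 1))) (h_symplecton a abar j (m + 1))"
    and "ad a abar Jm (h_symplecton a abar j m)
        = hscale (sqrt ((j + m) * (j - m + 1))) (h_symplecton a abar j (m - 1))"
    and "ad a abar J0 (h_symplecton a abar j m) = hscale (2 * m) (h_symplecton a abar j m)"
proof -
  note weight = commutator_symplecton(1)[folded realization_gen]
  note ad_weight = realization.twisted_ad_weight[folded ad_eq_twisted_ad, unfolded realization_gen(1)[THEN arg_cong[of _ _ sigma]]]
  show "ad a abar J0 (h_symplecton a abar j m) = hscale (2 * m) (h_symplecton a abar j m)"
    unfolding h_symplecton_def by (rule ad_weight) (rule weight[OF pq])+
  let ?up = "if p = 0 then 0 else symplecton a abar j (m + 1)"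
  \<comment> \<open>At the end of the range \<open>?up\<close> is 0, which has every weight, so
    \<open>ad_weight\<close> applies there as well.\<close>
  have "realization a abar J0 * ?up - ?up * realization a abar J0 = (2 * (m + 1)) *\<^sub>R ?up"
    using weight[of j "m + 1" "p - 1" "q + 1"] pq by (cases p) simp_all
  then have "ad a abar Jp (h_symplecton a abar j m)
      = hscale (sqrt ((j - m) * (j + m + 1))) (fps_const ?up * hexp (hscale (m + 1) (sigma (boson_Jp a))))"
    unfolding h_symplecton_def
    by (intro ad_weight weight[OF pq] commutator_symplecton(2)[OF pq, folded realization_gen])
  then show "ad a abar Jp (h_symplecton a abar j m)
      = hscale (sqrt ((j - m) * (j + m + 1))) (h_symplecton a abar j (m + 1))"
    using pq by (cases "p = 0") (simp_all add: h_symplecton_def)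
  let ?down = "if q = 0 then 0 else symplecton a abar j (m - 1)"
  have "realization a abar J0 * ?down - ?down * realization a abar J0 = (2 * (m - 1)) *\<^sub>R ?down"
    using weight[of j "m - 1" "p + 1" "q - 1"] pq by (cases q) simp_all
  then have "ad a abar Jm (h_symplecton a abar j m)
      = hscale (sqrt ((j + m) * (j - m + 1))) (fps_const ?down * hexp (hscale (m - 1) (sigma (boson_Jp a))))"
    unfolding h_symplecton_def
    by (intro ad_weight weight[OF pq] commutator_symplecton(3)[OF pq, folded realization_gen])
  then show "ad a abar Jm (h_symplecton a abar j m)
      = hscale (sqrt ((j + m) * (j - m + 1))) (h_symplecton a abar j (m - 1))"
    using pq by (cases "q = 0") (simp_all add: h_symplecton_def)
qed

end

theorem proposition5p1:
  fixes a abar :: "'a::real_algebra_1" and j m :: real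
  assumes boson: "abar * a - a * abar = 1"
    and j: "j \<in> {real k / 2 | k::nat. True}"
    and m: "m \<in> {- j + real k | k::nat. - j + real k \<le> j}"
  shows "sigma (boson_Jp a) = - hln (1 + hpar * fps_const (a\<^sup>2))
    \<and> ad a abar Jp (h_symplecton a abar j m)
        = hscale (sqrt ((j - m) * (j + m + 1))) (h_symplecton a abar j (m + 1))
    \<and> ad a abar Jm (h_symplecton a abar j m)
        = hscale (sqrt ((j + m) * (j - m + 1))) (h_symplecton a abar j (m - 1))
    \<and> ad a abar J0 (h_symplecton a abar j m)
        = hscale (2 * m) (h_symplecton a abar j m)"
proof -
  obtain k :: nat where k: "j = real k / 2"
    using j by blast
  obtain q :: nat where q: "m = - j + real q" "- j + real q \<le> j"
    using m by blast
  have "q \<le> k"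
    using q(2) k by simp
  then have pq: "j - m = real (k - q)" "j + m = real q"
    using k q(1) by simp_all
  have "1 - 2 * hpar * fps_const (boson_Jp a) = 1 + hpar * fps_const (a\<^sup>2)"
    by (auto simp: fps_eq_iff boson_Jp_def numeral_fps_const fps_X_def mult_2)
  then have "sigma (boson_Jp a) = - hln (1 + hpar * fps_const (a\<^sup>2))"
    by (simp only: sigma_def)
  then show ?thesis
    using ad_h_symplecton[OF boson pq] by blast
qed

end
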